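(* Let $$T_0=\frac{1}{4\|b'\|_\infty}\left(\log(c^{-1})-3\log(\log(c^{-1}))\right).$$ Then for every $x\in\mathbb{R}$ and every $\epsilon>0$, $$\lim_{c\to0}\mathbb{P}\left(\sup_{0\le t\le T_0}\left|X_{n(t)}(x)-\psi_t(x)\right|>\epsilon\right)=0 .$$
   Context: Setting (AHL$(\nu)$ model with slit particles). $\nu$ is a probability measure on the unit circle (identified with $[0,1]$ via $x\mapsto e^{2\pi i x}$) with density $h_\nu$ with respect to Lebesgue measure on $[0,1]$; $h_\nu$ is extended 1-periodically to $\mathbb{R}$, is twice continuously differentiable, and is not constant ($\nu$ is not uniform). Let $c\in(0,1/2)$ (particle capacity) and let $\theta_1,\theta_2,\dots$ be i.i.d. random variables in $[0,1]$ with density $h_\nu$. For $x\in(-1/2,1/2]$ set $\gamma(x)=\frac{\mathrm{sign}(x)}{\pi}\tan^{-1}\left(\sqrt{e^c\tan^2(\pi x)+e^c-1}\right)$ with $\gamma(1/2)=1/2$ (at $x=0$ either one-sided limit may be used; this is irrelevant almost surely), and for $x=k+a$, $k\in\mathbb{Z}$, $a\in(-1/2,1/2]$, set $\gamma(x)=k+\gamma(a)$. The harmonic measure flow is $X_0(x)=x$, $X_n(x)=\gamma(X_{n-1}(x)-\theta_n)+\theta_n$ for $n\ge1$, $x\in\mathbb{R}$ (it depends on $c$). Set $n(t)=\lfloor t/c\rfloor$. Let $b(x)=\frac{1}{2\pi}\int_0^1\cot(\pi z)\,(h_\nu(x-z)-h_\nu(x))\,dz$ for $x\in\mathbb{R}$,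 let $\|b'\|_\infty=\sup_x|b'(x)|$, and let $\psi_t(x)$, $t\ge0$, be the solution of $\dot\psi_t(x)=b(\psi_t(x))$, $\psi_0(x)=x$. *)

theory Defs
  imports "HOL-Probability.Probability"
begin

definition twice_cont_diff :: "(real \<Rightarrow> real) \<Rightarrow> bool" where
  "twice_cont_diff h \<longleftrightarrow>
     (\<forall>x. h differentiable (at x)) \<and> (\<forall>x. deriv h differentiable (at x)) \<and>
     continuous_on UNIV (deriv (deriv h))"

text \<open>The density of a probability measure on the circle with respect to Lebesgue measure on
  \<open>[0,1]\<close>, extended periodically to the real line.\<close>

definition circle_density :: "(real \<Rightarrow> real) \<Rightarrow> bool" where
  "circle_density h \<longleftrightarrow>
     (\<forall>x. 0 \<le> h x) \<and> (\<forall>x. h (x + 1) = h x) \<and>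
     set_integrable lborel {0..1} h \<and> set_lebesgue_integral lborel {0..1} h = 1"

text \<open>The slit map on the fundamental domain \<open>-1/2 < a \<le> 1/2\<close>.  It jumps at \<open>0\<close>, where either
  one-sided limit is admissible; \<open>\<sigma>\<close> is the sign used there.  The value at \<open>1/2\<close> is separate
  because \<open>tan (pi / 2) = 0\<close> by the library's totalisation of division.\<close>

definition slit_base :: "real \<Rightarrow> real \<Rightarrow> real \<Rightarrow> real" where
  "slit_base \<sigma> c a =
     (if a = 1/2 then 1/2
      else (if a = 0 then \<sigma> else sgn a) / pi *
             arctan (sqrt (exp c * (tan (pi * a))\<^sup>2 + exp c - 1)))"

text \<open>\<open>\<lceil>x - 1/2\<rceil>\<close> is the unique integer \<open>k\<close> with \<open>-1/2 < x - k \<le> 1/2\<close>.\<close>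

definition slit_map :: "real \<Rightarrow> real \<Rightarrow> real \<Rightarrow> real" where
  "slit_map \<sigma> c x = (let k = real_of_int \<lceil>x - 1/2\<rceil> in k + slit_base \<sigma> c (x - k))"

text \<open>The angles are indexed from \<open>1\<close>; \<open>\<theta> 0\<close> is never used.\<close>

primrec harmonic_flow :: "real \<Rightarrow> real \<Rightarrow> (nat \<Rightarrow> real) \<Rightarrow> nat \<Rightarrow> real \<Rightarrow> real" where
  "harmonic_flow \<sigma> c \<theta> 0 x = x"
| "harmonic_flow \<sigma> c \<theta> (Suc n) x =
     slit_map \<sigma> c (harmonic_flow \<sigma> c \<theta> n x - \<theta> (Suc n)) + \<theta> (Suc n)"

definition steps :: "real \<Rightarrow> real \<Rightarrow> nat" where
  "steps c t = nat \<lfloor>t / c\<rfloor>"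

definition drift :: "(real \<Rightarrow> real) \<Rightarrow> real \<Rightarrow> real" where
  "drift h x = 1 / (2 * pi) *
     set_lebesgue_integral lborel {0..1} (\<lambda>z. cot (pi * z) * (h (x - z) - h x))"

definition time_horizon :: "(real \<Rightarrow> real) \<Rightarrow> real \<Rightarrow> real" where
  "time_horizon h c =
     1 / (4 * (SUP x. \<bar>deriv (drift h) x\<bar>)) * (ln (inverse c) - 3 * ln (ln (inverse c)))"

end

theory Submission
  imports Defs "HOL-Real_Asymp.Real_Asymp"
begin

text \<open>
  Write \<open>P z = slit_map \<sigma> c z - z\<close> for the displacement caused by one slit, so that a step of the
  flow is \<open>X \<mapsto> X + P (X - \<theta>)\<close>.  Since \<open>cos (pi * slit_map \<sigma> c z) = exp (- c / 2) * cos (pi * z)\<close> for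
  \<open>\<bar>z\<bar> \<le> 1/2\<close>, the displacement is close to \<open>c / (2 * pi) * cot (pi * z)\<close> away from the slit and at
  most of order \<open>sqrt c\<close> near it.  The whole proof rests on two consequences.  The displacement is
  odd away from the integers, hence its mean under a density \<open>h\<close> only sees the increments \<open>h (x - z) - h x\<close>, which cancel the
  singularity of the cotangent; the mean is \<open>c * drift h x\<close> up to an error of order \<open>c powr (3/2)\<close>.
  The second moment is also of order \<open>c powr (3/2)\<close>.  Both estimates come from one integrable
  majorant, \<open>slit_kernel\<close>.

  Let \<open>D\<close> be the difference between the flow and the solution of the differential equation, sampled
  at the times \<open>n * c\<close>, and let \<open>L\<close> be the supremum of \<open>\<bar>b'\<bar>\<close>, a Lipschitz constant of the drift.
  The two moment estimates bound the conditional second moment of the next difference by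
  \<open>(1 + a) * D\<^sup>2 + d\<close> with \<open>a = 2 * L * c + K * c powr (3/2)\<close> and \<open>d = K * c powr (3/2)\<close>
  (\<open>second_moment_step\<close>).  Consequently
  \<open>(1 + a) ^ (N - n) * (D\<^sup>2 + (N - n) * d)\<close> is a nonnegative supermartingale in \<open>n\<close> which dominates
  \<open>D\<^sup>2\<close>, and the maximal inequality for such processes bounds the probability that \<open>\<bar>D\<bar>\<close> ever exceeds a
  level \<open>\<epsilon>\<close> up to step \<open>N\<close> by \<open>(1 + a) ^ N * (N * d) / \<epsilon>\<^sup>2\<close> (\<open>flow_maximal_inequality\<close>).

  With \<open>N * c \<le> T\<close> this is at most \<open>exp ((2 * L + K * sqrt c) * T) * K * sqrt c * T / \<epsilon>\<^sup>2\<close>.  For the time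
  horizon \<open>T\<close> of the theorem, \<open>exp (2 * L * T)\<close> equals
  \<open>ln (1 / c) powr (- 3/2) / sqrt c\<close> when \<open>L > 0\<close>: the power of \<open>c\<close> is exactly compensated by \<open>sqrt c\<close>, and the
  logarithmic correction beats the remaining factor \<open>T\<close>, which is of order \<open>ln (1 / c)\<close>.  The
  passage from the grid \<open>n * c\<close> to all times costs only \<open>O(c)\<close>, as the drift is bounded.
\<close>

section \<open>The displacement caused by one slit\<close>

lemma sin_pi_ge_two_mult:
  fixes z :: real
  assumes "0 \<le> z" "z \<le> 1/2"
  shows "2 * z \<le> sin (pi * z)"
proof -
  have "concave_on {0..1/2} (\<lambda>x. sin (pi * x))"
  proof (rule f''_le0_imp_concave)
    fix x :: real assume "x \<in> {0..1/2}"
    then have "0 \<le> sin (pi * x)"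
      by (intro sin_ge_zero) (auto simp: mult_left_le)
    then show "- (pi * (pi * sin (pi * x))) \<le> 0" by simp
  qed (auto intro!: derivative_eq_intros)
  from concave_onD[OF this, of "2 * z" 0 "1/2"] show ?thesis
    using assms by auto
qed

lemma sin_pi_ge_min:
  fixes z :: real
  assumes "0 \<le> z" "z \<le> 1"
  shows "2 * min z (1 - z) \<le> sin (pi * z)"
proof (cases "z \<le> 1/2")
  case True
  then show ?thesis using sin_pi_ge_two_mult[of z] assms by auto
next
  case False
  have "sin (pi * (1 - z)) = sin (pi * z)"
    by (simp add: right_diff_distrib)
  then show ?thesis using sin_pi_ge_two_mult[of "1 - z"] assms False by auto
qed

lemma abs_cot_times_sin: "\<bar>cot x * sin x\<bar> \<le> (1::real)"
  by (cases "sin x = 0") (auto simp: cot_def)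

text \<open>As a function of the capacity \<open>s\<close>, the angle \<open>arctan (sqrt (exp s * t\<^sup>2 + exp s - 1))\<close> solves the
  Loewner-type equation \<open>y' = cot y / 2\<close>; at \<open>s = 0\<close> it is \<open>arctan t\<close>.\<close>
lemma has_field_derivative_arctan_sqrt_exp:
  fixes t s :: real
  assumes "0 < t" "0 \<le> s"
  shows "((\<lambda>s. arctan (sqrt (exp s * t\<^sup>2 + exp s - 1))) has_real_derivative
           1 / (2 * sqrt (exp s * t\<^sup>2 + exp s - 1))) (at s)"
proof -
  have "exp s \<ge> 1" using assms by simp
  moreover have "exp s * t\<^sup>2 > 0" using assms by simp
  ultimately have "exp s * t\<^sup>2 + exp s - 1 > 0" by linarith
  then show ?thesis
    by (auto intro!: derivative_eq_intros simp: field_simps)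
qed

lemma exp_minus_one_le_double:
  fixes s :: real assumes "0 \<le> s" "s \<le> 1" shows "exp s - 1 \<le> 2 * s"
proof -
  have "exp s \<le> 1 + s + s\<^sup>2" using exp_bound assms by blast
  moreover have "s\<^sup>2 \<le> s" using assms by (simp add: power2_eq_square mult_left_le)
  ultimately show ?thesis by linarith
qed

text \<open>By the mean value theorem in the capacity, the increment is \<open>c / (2 * y)\<close> where
  \<open>y \<ge> t\<close> is the tangent of the angle at an intermediate capacity, which gives the bound \<open>c / (2 * t)\<close> and, from the control of
  \<open>y\<^sup>2 - t\<^sup>2\<close>, the second-order error.  The bound \<open>2 * sqrt c\<close> takes over when \<open>t\<close> is small, where
  \<open>c / (2 * t)\<close> is useless.\<close>
lemma arctan_slit_increment:
  fixes t c :: real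
  assumes t: "0 < t" and c: "0 < c" "c \<le> 1"
  defines "I \<equiv> arctan (sqrt (exp c * t\<^sup>2 + exp c - 1)) - arctan t"
  shows "0 \<le> I" "I \<le> c / (2 * t)" "I \<le> 2 * sqrt c"
    and "c / (2 * t) - I \<le> c\<^sup>2 * (1 + t\<^sup>2) / (2 * t ^ 3)"
proof -
  define y where "y s = sqrt (exp s * t\<^sup>2 + exp s - 1)" for s
  have y0: "y 0 = t" using t by (simp add: y_def)
  have "\<exists>s>0. s < c \<and> arctan (y c) - arctan (y 0) = (c - 0) * (1 / (2 * y s))"
    unfolding y_def
    by (rule MVT2) (use c t in \<open>auto intro!: has_field_derivative_arctan_sqrt_exp\<close>)
  then obtain s where s: "0 < s" "s < c" and I: "I = c / (2 * y s)"
    by (auto simp: y0 I_def) (auto simp: y_def)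
  have mono: "t \<le> y r" and ysq: "(y r)\<^sup>2 - t\<^sup>2 = (exp r - 1) * (1 + t\<^sup>2)" if "0 \<le> r" for r
  proof -
    have e: "exp r \<ge> 1" using that by simp
    have "exp r * t\<^sup>2 \<ge> 1 * t\<^sup>2" using e by (intro mult_right_mono) auto
    with e have ge: "exp r * t\<^sup>2 + exp r - 1 \<ge> t\<^sup>2" by linarith
    then show "t \<le> y r" unfolding y_def by (rule real_le_rsqrt)
    have "0 \<le> exp r * t\<^sup>2 + exp r - 1" using ge zero_le_power2[of t] by linarith
    then show "(y r)\<^sup>2 - t\<^sup>2 = (exp r - 1) * (1 + t\<^sup>2)" 
      by (simp add: y_def algebra_simps)
  qed
  have ys: "t \<le> y s" "0 < y s" using mono[of s] s t by auto
  show "0 \<le> I" using I ys c by simp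
  show le: "I \<le> c / (2 * t)" unfolding I using ys t c by (intro divide_left_mono) auto
  \<comment> \<open>For small \<open>t\<close> the arctangent is a contraction and \<open>(y c - t)\<^sup>2 \<le> (y c)\<^sup>2 - t\<^sup>2\<close>; for large \<open>t\<close> the
    previous bound suffices.\<close>
  show "I \<le> 2 * sqrt c"
  proof (cases "t \<le> 1")
    case True
    have yc: "t \<le> y c" using mono[of c] c by simp
    have "I \<le> y c - t"
    proof (cases "t = y c")
      case False
      with yc have "t < y c" by simp
      then have "\<exists>z>t. z < y c \<and> arctan (y c) - arctan t = (y c - t) * inverse (1 + z\<^sup>2)"
        by (intro MVT2) (auto intro!: DERIV_arctan)
      then obtain z where "arctan (y c) - arctan t = (y c - t) * inverse (1 + z\<^sup>2)" by auto
      moreover have "inverse (1 + z\<^sup>2) \<le> 1" by (simp add: inverse_le_1_iff)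
      ultimately show ?thesis using yc by (simp add: I_def y_def mult_left_le)
    qed (simp add: I_def y_def)
    also have "y c - t \<le> sqrt (4 * c)"
    proof (rule real_le_rsqrt)
      have "(y c - t)\<^sup>2 \<le> (y c)\<^sup>2 - t\<^sup>2" using yc t
        by (simp add: power2_eq_square algebra_simps)
      also have "\<dots> = (exp c - 1) * (1 + t\<^sup>2)" using ysq c by simp
      also have "\<dots> \<le> (2 * c) * 2"
        using exp_minus_one_le_double[of c] c True t
        by (intro mult_mono) (auto simp: power_le_one)
      finally show "(y c - t)\<^sup>2 \<le> 4 * c" by simp
    qed
    finally show ?thesis by (simp add: real_sqrt_mult)
  next
    case False
    have "c \<le> sqrt c" using c by (intro real_le_rsqrt) (simp add: power2_eq_square mult_left_le)
    moreover have "c / (2 * t) \<le> c / 2" using False c by (intro divide_left_mono) auto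
    ultimately show ?thesis using le c by linarith
  qed
  have "c / (2 * t) - I = c / 2 * (((y s)\<^sup>2 - t\<^sup>2) / (t * y s * (y s + t)))"
  proof -
    have "(y s)\<^sup>2 - t\<^sup>2 = (y s - t) * (y s + t)" by (simp add: power2_eq_square algebra_simps)
    then have "((y s)\<^sup>2 - t\<^sup>2) / (t * y s * (y s + t)) = (y s - t) / (t * y s)" using ys t by simp
    then show ?thesis unfolding I by (simp only:) (use ys t in \<open>simp add: field_simps\<close>)
  qed
  also have "\<dots> \<le> c / 2 * (((y s)\<^sup>2 - t\<^sup>2) / (t * t * (t + t)))"
  proof (intro mult_left_mono divide_left_mono)
    show "t * t * (t + t) \<le> t * y s * (y s + t)" using ys t by (intro mult_mono) auto
    show "0 \<le> (y s)\<^sup>2 - t\<^sup>2" using ys t by (simp add: power_mono)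
  qed (use c t ys in auto)
  also have "\<dots> \<le> c / 2 * ((2 * c * (1 + t\<^sup>2)) / (t * t * (t + t)))"
  proof (intro mult_left_mono divide_right_mono)
    have "(y s)\<^sup>2 - t\<^sup>2 = (exp s - 1) * (1 + t\<^sup>2)" using ysq s by simp
    also have "\<dots> \<le> (2 * c) * (1 + t\<^sup>2)"
      using exp_minus_one_le_double[of s] s c by (intro mult_right_mono) auto
    finally show "(y s)\<^sup>2 - t\<^sup>2 \<le> 2 * c * (1 + t\<^sup>2)" .
  qed (use c t in auto)
  also have "\<dots> = c\<^sup>2 * (1 + t\<^sup>2) / (2 * t ^ 3)"
    using t by (simp add: field_simps power2_eq_square power3_eq_cube)
  finally show "c / (2 * t) - I \<le> c\<^sup>2 * (1 + t\<^sup>2) / (2 * t ^ 3)" .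
qed

definition slit_shift :: "real \<Rightarrow> real \<Rightarrow> real \<Rightarrow> real" where
  "slit_shift \<sigma> c z = slit_map \<sigma> c z - z"

lemma slit_shift_periodic: "slit_shift \<sigma> c (z + 1) = slit_shift \<sigma> c z"
proof -
  have "\<lceil>z + 1 - 1/2\<rceil> = \<lceil>z - 1/2\<rceil> + 1"
    by (simp add: ceiling_eq_iff) linarith
  then show ?thesis by (simp add: slit_shift_def slit_map_def Let_def)
qed

lemma slit_base_uminus:
  assumes "-1/2 < a" "a < 1/2" "a \<noteq> 0"
  shows "slit_base \<sigma> c (- a) = - slit_base \<sigma> c a"
  using assms by (auto simp: slit_base_def sgn_if)

lemma slit_shift_one_half: "slit_shift \<sigma> c (1/2) = 0"
  by (simp add: slit_shift_def slit_map_def slit_base_def)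

text \<open>The endpoints have to be excluded: at \<open>z = 0\<close> the value depends on the sign \<open>\<sigma>\<close>, and oddness
  fails.\<close>
lemma slit_shift_reflect:
  assumes "0 < z" "z < 1"
  shows "slit_shift \<sigma> c (1 - z) = - slit_shift \<sigma> c z"
proof -
  have half: "slit_shift \<sigma> c (1 - z) = - slit_shift \<sigma> c z" if "0 < z" "z < 1/2" for z
  proof -
    have "\<lceil>z - 1/2\<rceil> = 0" "\<lceil>1 - z - 1/2\<rceil> = 1" using that by (auto simp: ceiling_eq_iff)
    then show ?thesis using that slit_base_uminus[of z \<sigma> c]
      by (simp add: slit_shift_def slit_map_def Let_def)
  qed
  consider "z < 1/2" | "z = 1/2" | "1/2 < z" by linarith
  then show ?thesis
  proof cases
    case 1 then show ?thesis using half assms by simp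
  next
    case 2 then show ?thesis by (metis (no_types) add_diff_cancel_left' field_sum_of_halves minus_zero slit_shift_one_half)
  next
    case 3 then show ?thesis using half[of "1 - z"] assms by simp
  qed
qed

lemma abs_slit_shift_le_one:
  assumes "0 \<le> c" "\<sigma> \<in> {-1, 1}"
  shows "\<bar>slit_shift \<sigma> c z\<bar> \<le> 1"
proof -
  define k where "k = real_of_int \<lceil>z - 1/2\<rceil>"
  have a: "\<bar>z - k\<bar> \<le> 1/2" unfolding k_def by linarith
  have sb: "\<bar>slit_base \<sigma> c a\<bar> \<le> 1/2" for a
  proof -
    let ?q = "sqrt (exp c * (tan (pi * a))\<^sup>2 + exp c - 1)"
    have "\<bar>arctan ?q\<bar> \<le> pi/2" using arctan_bounded[of ?q] by linarith
    then have "\<bar>arctan ?q\<bar> / pi \<le> 1/2" by (simp add: field_simps)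
    moreover have "\<bar>if a = 0 then \<sigma> else sgn a\<bar> = 1" using assms by (auto simp: sgn_if)
    ultimately show ?thesis unfolding slit_base_def by (auto simp: abs_mult)
  qed
  have "slit_shift \<sigma> c z = slit_base \<sigma> c (z - k) - (z - k)"
    by (simp add: slit_shift_def slit_map_def Let_def k_def)
  then show ?thesis using sb[of "z - k"] a by linarith
qed

text \<open>A smooth periodic substitute for the minimum of \<open>c\<close> and \<open>c\<^sup>2 / (sin (pi * z))\<^sup>2\<close>, the two regimes near
  to and far from the slit.\<close>
definition slit_kernel :: "real \<Rightarrow> real \<Rightarrow> real" where
  "slit_kernel c z = c\<^sup>2 / (c + (sin (pi * z))\<^sup>2)"

text \<open>Bounds by each of the two regimes combine into a bound by the kernel.\<close>
lemma min_le_slit_kernel: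
  assumes c: "0 < c" and u: "u \<le> 1" "u * (sin (pi * z))\<^sup>2 \<le> c"
  shows "c * u \<le> 2 * slit_kernel c z"
proof -
  have pos: "0 < c + (sin (pi * z))\<^sup>2" using c by (simp add: add_pos_nonneg)
  have "u * c \<le> c" using u c by simp
  with u(2) have "u * (c + (sin (pi * z))\<^sup>2) \<le> 2 * c" by (simp add: algebra_simps)
  then have "c * (u * (c + (sin (pi * z))\<^sup>2)) \<le> c * (2 * c)"
    using c by (intro mult_left_mono) auto
  then show ?thesis using pos
    by (simp add: slit_kernel_def pos_le_divide_eq power2_eq_square algebra_simps)
qed

text \<open>Here \<open>pi * slit_shift \<sigma> c z\<close> is the increment of the arctangent for \<open>t = tan (pi * z)\<close>.  In the second
  estimate the factor \<open>sin (pi * z)\<close> is what the increment of a Lipschitz density contributes; it turns the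
  error \<open>c\<^sup>2 / (sin (pi * z)) ^ 3\<close> into something that the kernel dominates.\<close>
lemma slit_shift_bounds_half:
  assumes z: "0 < z" "z < 1/2" and c: "0 < c" "c \<le> 1"
  shows "(pi * slit_shift \<sigma> c z)\<^sup>2 \<le> 8 * slit_kernel c z"
    and "sin (pi * z) * \<bar>pi * slit_shift \<sigma> c z - c / 2 * cot (pi * z)\<bar> \<le> slit_kernel c z"
proof -
  define s k t where "s = sin (pi * z)" and "k = cos (pi * z)" and "t = tan (pi * z)"
  have s: "0 < s" unfolding s_def using z by (intro sin_gt_zero) auto
  have k: "0 < k" unfolding k_def using z by (intro cos_gt_zero) auto
  have t: "t = s / k" by (simp add: t_def tan_def s_def k_def)
  have sk: "s\<^sup>2 + k\<^sup>2 = 1" by (simp add: s_def k_def)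
  have k1: "k \<le> 1" by (simp add: k_def)
  have tpos: "0 < t" using s k t by simp
  define I where "I = pi * slit_shift \<sigma> c z"
  have "\<lceil>z - 1/2\<rceil> = 0" using z by (auto simp: ceiling_eq_iff)
  moreover have "arctan (tan (pi * z)) = pi * z" 
  proof (rule arctan_tan)
    have "0 < pi * z" using z by simp
    then show "- (pi / 2) < pi * z" using pi_gt_zero by linarith
  qed (use z in auto)
  ultimately have I: "I = arctan (sqrt (exp c * t\<^sup>2 + exp c - 1)) - arctan t"
    using z by (simp add: I_def slit_shift_def slit_map_def slit_base_def t_def field_simps)
  note B = arctan_slit_increment[OF tpos c, folded I]
  have ct: "c / (2 * t) = c * k / (2 * s)" using t s k by simp
  have cs: "c * k / (2 * s) \<le> c / (2 * s)" using k1 c s by (intro divide_right_mono) auto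
  have I1: "I \<le> c / (2 * s)" using B(2) cs ct by linarith
  have cot: "c / 2 * cot (pi * z) = c / (2 * t)" using ct by (simp add: cot_def s_def k_def)
  have "c * (I\<^sup>2 / (4 * c)) \<le> 2 * slit_kernel c z"
  proof (rule min_le_slit_kernel)
    have "I\<^sup>2 \<le> (2 * sqrt c)\<^sup>2" using B(1,3) by (intro power_mono) auto
    then show "I\<^sup>2 / (4 * c) \<le> 1" using c by (simp add: power_mult_distrib)
    have "I * s \<le> c / 2" using I1 s by (simp add: field_simps)
    then have "(I * s)\<^sup>2 \<le> (c / 2)\<^sup>2" using B(1) s by (intro power_mono) auto
    then have "(I * s)\<^sup>2 \<le> c\<^sup>2 / 4" by (simp add: power_divide)
    moreover have "c\<^sup>2 / 4 \<le> 4 * c\<^sup>2" by simp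
    ultimately have "(I * s)\<^sup>2 \<le> 4 * c\<^sup>2" by linarith
    then have "I\<^sup>2 * s\<^sup>2 \<le> c * (4 * c)" by (simp add: power_mult_distrib power2_eq_square algebra_simps)
    then show "I\<^sup>2 / (4 * c) * (sin (pi * z))\<^sup>2 \<le> c"
      using c by (simp add: s_def[symmetric] field_simps)
  qed (use c in auto)
  then show "(pi * slit_shift \<sigma> c z)\<^sup>2 \<le> 8 * slit_kernel c z" using c by (simp add: I_def)
  define R where "R = c / (2 * t) - I"
  have R0: "0 \<le> R" using B(2) by (simp add: R_def)
  have "R \<le> c / (2 * s)" using B(1) cs ct R_def by linarith
  then have Rs: "s * R \<le> c / 2" using s by (simp add: field_simps)
  have "R \<le> c\<^sup>2 * (1 + t\<^sup>2) / (2 * t ^ 3)" using B(4) by (simp add: R_def)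
  also have "1 + t\<^sup>2 = 1 / k\<^sup>2" using sk k by (simp add: t field_simps)
  also have "c\<^sup>2 * (1 / k\<^sup>2) / (2 * t ^ 3) = c\<^sup>2 * k / (2 * s ^ 3)"
    using s k by (simp add: t field_simps power2_eq_square power3_eq_cube)
  also have "\<dots> \<le> c\<^sup>2 / (2 * s ^ 3)" using k1 c s by (intro divide_right_mono) (auto simp: mult_left_le)
  finally have R3: "s ^ 3 * R \<le> c\<^sup>2 / 2" using s by (simp add: field_simps)
  have "c * (2 * (s * R) / c) \<le> 2 * slit_kernel c z"
  proof (rule min_le_slit_kernel)
    show "2 * (s * R) / c \<le> 1" using Rs c by simp
    show "2 * (s * R) / c * (sin (pi * z))\<^sup>2 \<le> c"
      using R3 c by (simp add: s_def[symmetric] field_simps power2_eq_square power3_eq_cube)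
  qed (use c in auto)
  then have "s * R \<le> slit_kernel c z" using c by simp
  moreover have "\<bar>pi * slit_shift \<sigma> c z - c / 2 * cot (pi * z)\<bar> = R"
    using R0 unfolding cot R_def I_def by linarith
  ultimately show "sin (pi * z) * \<bar>pi * slit_shift \<sigma> c z - c / 2 * cot (pi * z)\<bar> \<le> slit_kernel c z"
    by (simp add: s_def)
qed

lemma slit_shift_bounds:
  assumes z: "0 < z" "z < 1" and c: "0 < c" "c \<le> 1"
  shows "(pi * slit_shift \<sigma> c z)\<^sup>2 \<le> 8 * slit_kernel c z"
    and "sin (pi * z) * \<bar>pi * slit_shift \<sigma> c z - c / 2 * cot (pi * z)\<bar> \<le> slit_kernel c z"
proof -
  have "(pi * slit_shift \<sigma> c z)\<^sup>2 \<le> 8 * slit_kernel c z \<and>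
    sin (pi * z) * \<bar>pi * slit_shift \<sigma> c z - c / 2 * cot (pi * z)\<bar> \<le> slit_kernel c z"
  proof -
    consider "z < 1/2" | "z = 1/2" | "1/2 < z" by linarith
    then show ?thesis
    proof cases
      case 1 then show ?thesis using slit_shift_bounds_half z c by simp
    next
      case 2
      then have "slit_shift \<sigma> c z = 0" by (simp only: slit_shift_one_half)
      moreover have "cot (pi * z) = 0" unfolding 2 by (simp add: cot_def)
      moreover have "0 \<le> slit_kernel c z" using c by (simp add: slit_kernel_def)
      ultimately show ?thesis by simp
    next
      case 3
      define w where "w = 1 - z"
      have w: "0 < w" "w < 1/2" using 3 z by (auto simp: w_def)
      have sh: "slit_shift \<sigma> c z = - slit_shift \<sigma> c w"
        using slit_shift_reflect[of z \<sigma> c] z by (simp add: w_def)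
      have pz: "pi * z = pi - pi * w" by (simp add: w_def algebra_simps)
      have sn: "sin (pi * z) = sin (pi * w)" "cot (pi * z) = - cot (pi * w)"
        by (simp_all add: pz cot_def)
      have kk: "slit_kernel c z = slit_kernel c w" by (simp add: slit_kernel_def sn)
      have "\<bar>pi * - slit_shift \<sigma> c w - c / 2 * - cot (pi * w)\<bar>
         = \<bar>pi * slit_shift \<sigma> c w - c / 2 * cot (pi * w)\<bar>" by (simp add: abs_minus_commute)
      then show ?thesis using slit_shift_bounds_half[OF w c, of \<sigma>] by (simp add: sh sn kk)
    qed
  qed
  then show "(pi * slit_shift \<sigma> c z)\<^sup>2 \<le> 8 * slit_kernel c z"
    and "sin (pi * z) * \<bar>pi * slit_shift \<sigma> c z - c / 2 * cot (pi * z)\<bar> \<le> slit_kernel c z" by auto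
qed

section \<open>Integrals over one period\<close>

lemma set_integrable_Icc_bounded:
  fixes f :: "real \<Rightarrow> real"
  assumes "f \<in> borel_measurable borel" "\<And>z. z \<in> {a..b} \<Longrightarrow> \<bar>f z\<bar> \<le> C"
  shows "set_integrable lborel {a..b} f"
  unfolding set_integrable_def using assms
  by (intro integrableI_bounded_set_indicator[where B=C]) (auto simp: emeasure_lborel_Icc_eq)

lemma abs_LINT_unit_interval_le:
  fixes f :: "real \<Rightarrow> real"
  assumes "f \<in> borel_measurable borel" "\<And>z. z \<in> {0..1} \<Longrightarrow> \<bar>f z\<bar> \<le> C"
  shows "\<bar>LINT z:{0..1}|lborel. f z\<bar> \<le> C"
proof -
  have "\<bar>LINT z:{0..1}|lborel. f z\<bar> \<le> (LINT z:{0..1}|lborel. \<bar>f z\<bar>)"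
    unfolding set_lebesgue_integral_def
    by (rule order_trans[OF integral_abs_bound]) (simp add: abs_mult)
  also have "\<dots> \<le> (LINT z:{0..1::real}|lborel. C)"
    using assms by (intro set_integral_mono set_integrable_abs set_integrable_Icc_bounded[OF assms(1)])
      (auto simp: set_integrable_def)
  also have "\<dots> = C" by (simp add: set_lebesgue_integral_def)
  finally show ?thesis .
qed

lemma LINT_Icc_affine:
  fixes f :: "real \<Rightarrow> real"
  shows "(LINT z:{a..b}|lborel. f (z + s)) = (LINT z:{a+s..b+s}|lborel. f z)"
    and "(LINT z:{a..b}|lborel. f (s - z)) = (LINT z:{s-b..s-a}|lborel. f z)"
proof -
  have "(LINT z:{a+s..b+s}|lborel. f z) = (\<integral>z. indicator {a+s..b+s} (s + 1 * z) *\<^sub>R f (s + 1 * z) \<partial>lborel)"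
    unfolding set_lebesgue_integral_def by (subst lborel_integral_real_affine[of 1 _ s]) auto
  also have "\<dots> = (LINT z:{a..b}|lborel. f (z + s))"
    unfolding set_lebesgue_integral_def
    by (intro Bochner_Integration.integral_cong) (auto simp: indicator_def add.commute)
  finally show "(LINT z:{a..b}|lborel. f (z + s)) = (LINT z:{a+s..b+s}|lborel. f z)" ..
  have "(LINT z:{s-b..s-a}|lborel. f z) = (\<integral>z. indicator {s-b..s-a} (s + (-1) * z) *\<^sub>R f (s + (-1) * z) \<partial>lborel)"
    unfolding set_lebesgue_integral_def by (subst lborel_integral_real_affine[of "-1" _ s]) auto
  also have "\<dots> = (LINT z:{a..b}|lborel. f (s - z))"
    unfolding set_lebesgue_integral_def
    by (intro Bochner_Integration.integral_cong) (auto simp: indicator_def)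
  finally show "(LINT z:{a..b}|lborel. f (s - z)) = (LINT z:{s-b..s-a}|lborel. f z)" ..
qed

lemma LINT_Icc_combine:
  fixes f :: "real \<Rightarrow> real"
  assumes "a \<le> b" "b \<le> c" and meas: "f \<in> borel_measurable borel" and bdd: "\<And>z. \<bar>f z\<bar> \<le> C"
  shows "(LINT z:{a..b}|lborel. f z) + (LINT z:{b..c}|lborel. f z) = (LINT z:{a..c}|lborel. f z)"
proof -
  have "(LBINT z=a..b. f z) + (LBINT z=b..c. f z) = (LBINT z=a..c. f z)"
  proof (rule interval_integral_sum)
    have "set_integrable lborel {a..c} f" using meas bdd by (rule set_integrable_Icc_bounded)
    then have "set_integrable lborel (einterval a c) f"
      by (rule set_integrable_subset) (auto simp: einterval_def)
    then show "interval_lebesgue_integrable lborel (min (ereal a) (min (ereal b) (ereal c)))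
        (max (ereal a) (max (ereal b) (ereal c))) f"
      using assms(1,2) by (simp add: interval_lebesgue_integrable_def min_def max_def)
  qed
  then show ?thesis using assms(1,2) by (simp add: interval_integral_Icc)
qed

lemma periodic_int:
  fixes f :: "real \<Rightarrow> 'b"
  assumes per: "\<And>z. f (z + 1) = f z"
  shows "f (z + of_int k) = f z"
proof (induction k rule: int_induct[of _ 0])
  case (step1 i)
  then show ?case using per[of "z + of_int i"] by (simp add: add.assoc)
next
  case (step2 i)
  then show ?case using per[of "z + of_int (i - 1)"] by (simp add: algebra_simps)
qed simp

text \<open>Cutting a window of length one at the integer that it contains and moving one of the two pieces by
  a period turns it into a window that starts at an integer.\<close>

lemma LINT_periodic_reflect:
  fixes f :: "real \<Rightarrow> real"
  assumes per: "\<And>z. f (z + 1) = f z"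
    and meas: "f \<in> borel_measurable borel" and bdd: "\<And>z. \<bar>f z\<bar> \<le> C"
  shows "(LINT y:{0..1}|lborel. f (x - y)) = (LINT z:{0..1}|lborel. f z)"
proof -
  define a k where "a = x - 1" and "k = real_of_int \<lfloor>x - 1\<rfloor>"
  have k: "k \<le> a" "a \<le> k + 1" unfolding a_def k_def by linarith+
  note comb = LINT_Icc_combine[OF _ _ meas bdd]
  have "(LINT y:{0..1}|lborel. f (x - y)) = (LINT z:{a..a+1}|lborel. f z)"
    by (simp add: LINT_Icc_affine(2) a_def)
  also have "\<dots> = (LINT z:{a..k+1}|lborel. f z) + (LINT z:{k+1..a+1}|lborel. f z)"
    using k by (intro comb[symmetric]) auto
  also have "(LINT z:{k+1..a+1}|lborel. f z) = (LINT z:{k..a}|lborel. f z)"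
    by (simp add: LINT_Icc_affine(1)[symmetric] per)
  also have "(LINT z:{a..k+1}|lborel. f z) + (LINT z:{k..a}|lborel. f z) = (LINT z:{0+k..1+k}|lborel. f z)"
    using comb[OF k] by (simp add: add.commute)
  also have "\<dots> = (LINT z:{0..1}|lborel. f (z + k))"
    by (simp only: LINT_Icc_affine(1))
  also have "\<dots> = (LINT z:{0..1}|lborel. f z)"
    by (simp only: k_def periodic_int[of f, OF per])
  finally show ?thesis .
qed

lemma LINT_antisymmetric_zero:
  fixes f :: "real \<Rightarrow> real"
  assumes anti: "\<And>z. 0 < z \<Longrightarrow> z < 1 \<Longrightarrow> f (1 - z) = - f z" 
    and [measurable]: "f \<in> borel_measurable borel"
  shows "(LINT z:{0..1}|lborel. f z) = 0"
proof -
  have "(LINT z:{0..1}|lborel. f z) = (LINT z:{0..1}|lborel. f (1 - z))"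
    by (simp add: LINT_Icc_affine(2))
  also have "\<dots> = (LINT z:{0..1}|lborel. - f z)"
    unfolding set_lebesgue_integral_def
  proof (rule integral_cong_AE)
    show "AE z in lborel. indicator {0..1} z *\<^sub>R f (1 - z) = indicator {0..1} z *\<^sub>R - f z"
      using AE_lborel_singleton[of 0] AE_lborel_singleton[of 1]
      by eventually_elim (use anti in \<open>auto simp: indicator_def\<close>)
  qed auto
  also have "\<dots> = - (LINT z:{0..1}|lborel. f z)"
    by (simp add: set_lebesgue_integral_def)
  finally show ?thesis by simp
qed

lemma borel_measurable_tan_cot [measurable]:
  "(tan :: real \<Rightarrow> real) \<in> borel_measurable borel" "(cot :: real \<Rightarrow> real) \<in> borel_measurable borel"
  unfolding tan_def[abs_def] cot_def by measurable

lemma borel_measurable_slit_map [measurable]: "slit_map \<sigma> c \<in> borel_measurable borel"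
  unfolding slit_map_def[abs_def] slit_base_def[abs_def] Let_def by measurable

lemma borel_measurable_slit_shift [measurable]: "slit_shift \<sigma> c \<in> borel_measurable borel"
  unfolding slit_shift_def[abs_def] by measurable

lemma borel_measurable_slit_kernel [measurable]: "slit_kernel c \<in> borel_measurable borel"
  unfolding slit_kernel_def[abs_def] by measurable

lemma slit_kernel_nonneg: "0 < c \<Longrightarrow> 0 \<le> slit_kernel c z"
  by (simp add: slit_kernel_def)

lemma set_integrable_slit_kernel:
  assumes "0 < c" shows "set_integrable lborel {0..1} (slit_kernel c)"
proof (rule set_integrable_Icc_bounded)
  fix z
  have "c\<^sup>2 / (c + (sin (pi * z))\<^sup>2) \<le> c\<^sup>2 / c"
    using assms by (intro divide_left_mono) (auto simp: add_pos_nonneg)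
  then show "\<bar>slit_kernel c z\<bar> \<le> c"
    using slit_kernel_nonneg[OF assms, of z] assms
    by (simp add: slit_kernel_def power2_eq_square)
qed auto

text \<open>Replacing \<open>sin (pi * z)\<close> by \<open>2 * min z (1 - z)\<close> makes the kernel explicitly integrable, with
  an arctangent at scale \<open>sqrt c\<close> as primitive.  This is the source of the exponent \<open>3/2\<close>.\<close>
lemma LINT_slit_kernel_le:
  assumes c: "0 < c"
  shows "(LINT z:{0..1}|lborel. slit_kernel c z) \<le> 2 * (c * sqrt c)"
proof -
  define f where "f z = c\<^sup>2 / (c + (2 * z)\<^sup>2)" for z
  have fpos: "0 < c + (2 * z)\<^sup>2" for z using c by (simp add: add_pos_nonneg)
  have cont: "continuous_on {0..1} (\<lambda>z. f z + f (1 - z))"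
    unfolding f_def using fpos by (intro continuous_intros) (metis less_irrefl)+
  have le: "slit_kernel c z \<le> f z + f (1 - z)" if z: "z \<in> {0..1}" for z
  proof -
    have *: "slit_kernel c z \<le> f w" if "0 \<le> w" "2 * w \<le> sin (pi * z)" for w
      unfolding slit_kernel_def f_def using that c fpos[of w]
      by (intro divide_left_mono add_left_mono power_mono mult_pos_pos)
         (auto simp: add_pos_nonneg)
    have "0 \<le> f z" "0 \<le> f (1 - z)" using c by (auto simp: f_def)
    then show ?thesis using sin_pi_ge_min[of z] z *[of z] *[of "1 - z"]
      by (cases "z \<le> 1 - z") (auto simp: min_def)
  qed
  define F where "F z = c * sqrt c / 2 * (arctan (2 * z / sqrt c) - arctan (2 * (1 - z) / sqrt c))" for z
  have "(LINT z:{0..1}|lborel. slit_kernel c z) \<le> (LINT z:{0..1}|lborel. f z + f (1 - z))"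
    using set_integrable_slit_kernel[OF c] borel_integrable_atLeastAtMost'[OF cont] le
    by (intro set_integral_mono) auto
  also have "\<dots> = F 1 - F 0"
    unfolding set_lebesgue_integral_def
  proof (rule integral_FTC_atLeastAtMost[OF _ _ cont])
    fix z :: real
    have deriv: "(F has_real_derivative f z + f (1 - z)) (at z)"
    proof -
      have der: "((\<lambda>w. c * sqrt c / 2 * arctan (2 * w / sqrt c)) has_real_derivative f w) (at w)" for w
      proof -
        have "c * sqrt c / 2 * (inverse (1 + (2 * w / sqrt c)\<^sup>2) * (2 / sqrt c)) = f w"
        proof -
          have "1 + (2 * w / sqrt c)\<^sup>2 = (c + (2 * w)\<^sup>2) / c"
            using c by (simp add: power_divide add_divide_distrib)
          then have "inverse (1 + (2 * w / sqrt c)\<^sup>2) = c / (c + (2 * w)\<^sup>2)" by simp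
          moreover have "c * sqrt c / 2 * (u * (2 / sqrt c)) = c * u" for u using c by simp
          ultimately show ?thesis by (simp only: f_def power2_eq_square[of c] times_divide_eq_right)
        qed
        moreover have "((\<lambda>w. c * sqrt c / 2 * arctan (2 * w / sqrt c)) has_real_derivative
             c * sqrt c / 2 * (inverse (1 + (2 * w / sqrt c)\<^sup>2) * (2 / sqrt c))) (at w)"
          by (intro DERIV_cmult DERIV_chain2[OF DERIV_arctan] DERIV_cdivide DERIV_cmult_Id)
        ultimately show ?thesis by (simp only:)
      qed
      have "((\<lambda>w. c * sqrt c / 2 * arctan (2 * (1 - w) / sqrt c)) has_real_derivative f (1 - z) * (-1)) (at z)"
        by (rule DERIV_chain2[where f="\<lambda>w. c * sqrt c / 2 * arctan (2 * w / sqrt c)" and g="\<lambda>w. 1 - w", OF der])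
           (auto intro!: derivative_eq_intros)
      from DERIV_diff[OF der this] show ?thesis
        by (simp add: F_def[abs_def] right_diff_distrib)
    qed
    then show "(F has_vector_derivative f z + f (1 - z)) (at z within {0..1})"
      by (auto simp: has_real_derivative_iff_has_vector_derivative[symmetric] intro: DERIV_subset)
  qed simp
  also have "\<dots> = c * sqrt c * arctan (2 / sqrt c)" by (simp add: F_def)
  also have "\<dots> \<le> c * sqrt c * 2"
    using arctan_ubound[of "2 / sqrt c"] pi_less_4 c by (intro mult_left_mono) auto
  finally show ?thesis by simp
qed

lemma abs_LINT_le_slit_kernel:
  fixes f :: "real \<Rightarrow> real"
  assumes f: "\<And>z. 0 < z \<Longrightarrow> z < 1 \<Longrightarrow> \<bar>f z\<bar> \<le> C * slit_kernel c z" and "0 < c" "0 \<le> C"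
  shows "\<bar>LINT z:{0..1}|lborel. f z\<bar> \<le> 2 * C * (c * sqrt c)"
proof -
  have "\<bar>LINT z:{0..1}|lborel. f z\<bar> \<le> (\<integral>z. \<bar>indicator {0..1} z *\<^sub>R f z\<bar> \<partial>lborel)"
    unfolding set_lebesgue_integral_def by (rule integral_abs_bound)
  also have "\<dots> \<le> (\<integral>z. indicator {0..1} z *\<^sub>R (C * slit_kernel c z) \<partial>lborel)"
  proof (rule integral_mono_AE')
    show "integrable lborel (\<lambda>z. indicator {0..1} z *\<^sub>R (C * slit_kernel c z))"
      using set_integrable_mult_right[OF set_integrable_slit_kernel[OF \<open>0 < c\<close>], of C]
      unfolding set_integrable_def by simp
    show "AE z in lborel. \<bar>indicator {0..1} z *\<^sub>R f z\<bar> \<le> indicator {0..1} z *\<^sub>R (C * slit_kernel c z)"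
      using AE_lborel_singleton[of 0] AE_lborel_singleton[of 1]
      by eventually_elim (use f in \<open>auto simp: indicator_def\<close>)
    show "AE z in lborel. 0 \<le> indicator {0..1} z *\<^sub>R (C * slit_kernel c z)"
      using assms(3) slit_kernel_nonneg[OF assms(2)] by (intro AE_I2) auto
  qed
  also have "\<dots> = (LINT z:{0..1}|lborel. C * slit_kernel c z)"
    unfolding set_lebesgue_integral_def ..
  also have "\<dots> = C * (LINT z:{0..1}|lborel. slit_kernel c z)"
    by (rule set_integral_mult_right)
  also have "\<dots> \<le> C * (2 * (c * sqrt c))"
    using LINT_slit_kernel_le assms by (intro mult_left_mono) auto
  finally show ?thesis by simp
qed

lemma periodic_bounded:
  fixes f :: "real \<Rightarrow> real"
  assumes "\<And>z. f (z + 1) = f z" "continuous_on UNIV f"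
  obtains C where "0 \<le> C" "\<And>z. \<bar>f z\<bar> \<le> C"
proof -
  have "compact (f ` {0..1})"
    using assms(2) by (intro compact_continuous_image) (auto intro: continuous_on_subset)
  then obtain C where C: "\<forall>y\<in>f ` {0..1}. norm y \<le> C"
    using compact_imp_bounded bounded_iff by metis
  have "\<bar>f z\<bar> \<le> C" for z
  proof -
    have "f z = f (frac z)"
      using periodic_int[of f "frac z" "\<lfloor>z\<rfloor>"] assms(1) by (simp add: frac_def)
    moreover have "frac z \<in> {0..1}" using frac_lt_1[of z] by (simp add: less_imp_le)
    ultimately show ?thesis using C by auto
  qed
  moreover have "0 \<le> C" using calculation[of 0] by linarith
  ultimately show ?thesis using that by blast
qed

text \<open>A step by \<open>z\<close> to the left has the same effect as a step by \<open>1 - z\<close> to the right, so the increment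
  vanishes at both ends of the period, like the sine.\<close>
lemma periodic_lipschitz_increment:
  fixes f :: "real \<Rightarrow> real"
  assumes per: "\<And>z. f (z + 1) = f z" and lip: "\<And>x y. \<bar>f x - f y\<bar> \<le> K * \<bar>x - y\<bar>"
    and z: "z \<in> {0..1}"
  shows "\<bar>f (x - z) - f x\<bar> \<le> K * sin (pi * z)"
proof -
  have K: "0 \<le> K" using lip[of 1 0] abs_ge_zero[of "f 1 - f 0"] by simp
  have "f (x - z) = f (x + (1 - z))" using per[of "x - z"] by (simp add: algebra_simps)
  then have "\<bar>f (x - z) - f x\<bar> \<le> K * min z (1 - z)"
    using lip[of "x - z" x] lip[of "x + (1 - z)" x] z by (auto simp: min_def)
  also have "\<dots> \<le> K * sin (pi * z)"
    using sin_pi_ge_min[of z] z K by (intro mult_left_mono) (auto simp: min_def)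
  finally show ?thesis .
qed

lemma cot_times_increment_bounded:
  assumes "\<bar>u\<bar> \<le> K * sin (pi * z)" "0 \<le> K"
  shows "\<bar>cot (pi * z) * u\<bar> \<le> K"
proof -
  have "\<bar>cot (pi * z) * u\<bar> \<le> \<bar>cot (pi * z)\<bar> * (K * sin (pi * z))"
    using assms by (simp add: abs_mult mult_left_mono)
  also have "\<dots> \<le> \<bar>cot (pi * z)\<bar> * (K * \<bar>sin (pi * z)\<bar>)"
    using assms by (intro mult_left_mono) auto
  also have "\<dots> = K * \<bar>cot (pi * z) * sin (pi * z)\<bar>"
    by (simp add: abs_mult mult_ac)
  also have "\<dots> \<le> K" using abs_cot_times_sin assms(2) by (intro mult_left_le) auto
  finally show ?thesis .
qed

section \<open>The drift field\<close>

locale smooth_circle_density =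
  fixes h :: "real \<Rightarrow> real"
  assumes density: "circle_density h" and smooth: "twice_cont_diff h"
begin

lemma density_nonneg: "0 \<le> h x" and density_periodic: "h (x + 1) = h x"
  and density_integral: "(LINT y:{0..1}|lborel. h y) = 1"
  using density by (auto simp: circle_density_def)

lemma DERIV_density: "(h has_real_derivative deriv h x) (at x)"
  and DERIV_density2: "(deriv h has_real_derivative deriv (deriv h) x) (at x)"
  using smooth by (auto simp: twice_cont_diff_def DERIV_deriv_iff_real_differentiable)

lemma continuous_density: "continuous_on UNIV h" "continuous_on UNIV (deriv h)"
  using DERIV_density DERIV_density2
  by (auto intro!: DERIV_continuous_on simp: DERIV_subset)

lemma borel_measurable_density [measurable]:
  "h \<in> borel_measurable borel" "deriv h \<in> borel_measurable borel"
  using continuous_density by (auto intro: borel_measurable_continuous_onI)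

lemma deriv_periodic:
  fixes f :: "real \<Rightarrow> real"
  assumes "\<And>z. f (z + 1) = f z" shows "deriv f (z + 1) = deriv f z"
proof -
  have "(f has_real_derivative D) (at (z + 1)) \<longleftrightarrow> (f has_real_derivative D) (at z)" for D
    using DERIV_shift[of f D z 1] assms by simp
  then show ?thesis by (simp add: deriv_def)
qed

lemma density_bounds:
  obtains K where "0 \<le> K" "\<And>x. \<bar>h x\<bar> \<le> K"
    "\<And>x z. z \<in> {0..1} \<Longrightarrow> \<bar>h (x - z) - h x\<bar> \<le> K * sin (pi * z)"
    "\<And>x z. z \<in> {0..1} \<Longrightarrow> \<bar>deriv h (x - z) - deriv h x\<bar> \<le> K * sin (pi * z)"
proof -
  have per1: "deriv h (z + 1) = deriv h z" for z
    using deriv_periodic[of h] density_periodic by blast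
  have per2: "deriv (deriv h) (z + 1) = deriv (deriv h) z" for z
    using deriv_periodic[of "deriv h"] per1 by blast
  obtain K0 where K0: "\<And>x. \<bar>h x\<bar> \<le> K0" "0 \<le> K0"
    using periodic_bounded[of h] density_periodic continuous_density by metis
  obtain K1 where K1: "\<And>x. \<bar>deriv h x\<bar> \<le> K1" "0 \<le> K1"
    using periodic_bounded[of "deriv h"] per1 continuous_density by metis
  obtain K2 where K2: "\<And>x. \<bar>deriv (deriv h) x\<bar> \<le> K2" "0 \<le> K2"
    using periodic_bounded[of "deriv (deriv h)"] per2 smooth
    unfolding twice_cont_diff_def by metis
  define K where "K = K0 + K1 + K2"
  have lip1: "\<bar>h x - h y\<bar> \<le> K * \<bar>x - y\<bar>" for x y
    using field_differentiable_bound[of UNIV h "deriv h" K x y] DERIV_density K0 K1 K2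
    by (force simp: K_def intro: add_increasing add_increasing2)
  have lip2: "\<bar>deriv h x - deriv h y\<bar> \<le> K * \<bar>x - y\<bar>" for x y
    using field_differentiable_bound[of UNIV "deriv h" "deriv (deriv h)" K x y] DERIV_density2 K0 K1 K2
    by (force simp: K_def intro: add_increasing add_increasing2)
  show ?thesis
  proof (rule that[of K])
    show "0 \<le> K" using K0 K1 K2 by (simp add: K_def)
    show "\<bar>h x\<bar> \<le> K" for x using K0(1)[of x] K1 K2 by (simp add: K_def)
  qed (intro periodic_lipschitz_increment density_periodic lip1 per1 lip2; assumption)+
qed

lemma drift_bounded:
  obtains B where "0 \<le> B" "\<And>x. \<bar>drift h x\<bar> \<le> B"
proof -
  obtain K where K: "0 \<le> K" "\<And>x z. z \<in> {0..1} \<Longrightarrow> \<bar>h (x - z) - h x\<bar> \<le> K * sin (pi * z)"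
    using density_bounds by metis
  show ?thesis
  proof (rule that[of "1 / (2 * pi) * K"])
    show "0 \<le> 1 / (2 * pi) * K" using K by simp
    fix x
    have le: "\<bar>cot (pi * z) * (h (x - z) - h x)\<bar> \<le> K" if "z \<in> {0..1}" for z
      using K that by (intro cot_times_increment_bounded) auto
    have "\<bar>LINT z:{0..1}|lborel. cot (pi * z) * (h (x - z) - h x)\<bar> \<le> K"
      using le by (intro abs_LINT_unit_interval_le) auto
    then show "\<bar>drift h x\<bar> \<le> 1 / (2 * pi) * K"
      unfolding drift_def abs_mult by (simp add: mult_left_mono divide_right_mono)
  qed
qed

text \<open>Differentiation under the integral sign: the difference quotients of \<open>h (x - z) - h x\<close> in \<open>x\<close> are
  bounded by a multiple of \<open>sin (pi * z)\<close>, because the second derivative of \<open>h\<close> is bounded, and the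
  singularity of the cotangent is therefore dominated uniformly.\<close>
lemma DERIV_drift:
  "(drift h has_real_derivative
     1 / (2 * pi) * (LINT z:{0..1}|lborel. cot (pi * z) * (deriv h (x - z) - deriv h x))) (at x)"
proof -
  obtain K where K: "0 \<le> K" "\<And>x z. z \<in> {0..1} \<Longrightarrow> \<bar>h (x - z) - h x\<bar> \<le> K * sin (pi * z)"
     "\<And>x z. z \<in> {0..1} \<Longrightarrow> \<bar>deriv h (x - z) - deriv h x\<bar> \<le> K * sin (pi * z)"
    using density_bounds by metis
  define g where "g z y = h (y - z) - h y" for z y
  define g' where "g' z y = deriv h (y - z) - deriv h y" for z y
  have gD: "(g z has_real_derivative g' z y) (at y)" for z y
    unfolding g_def g'_def
    by (intro DERIV_diff DERIV_density DERIV_chain2[OF DERIV_density, THEN DERIV_cong])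
       (auto intro!: derivative_eq_intros)
  have int: "set_integrable lborel {0..1} (\<lambda>z. cot (pi * z) * g z y)" for y
    using K unfolding g_def
    by (intro set_integrable_Icc_bounded[where C=K] cot_times_increment_bounded) auto
  have quot: "\<bar>cot (pi * z) * ((g z (x + s) - g z x) / s)\<bar> \<le> K" if z: "z \<in> {0..1}" and "s \<noteq> 0" for z s
  proof (rule cot_times_increment_bounded[OF _ K(1)])
    have "norm (g z (x + s) - g z x) \<le> K * sin (pi * z) * norm (x + s - x)"
      using K(3)[OF z] gD[of z]
      by (intro field_differentiable_bound[of UNIV _ "g' z"]) (auto simp: g'_def)
    then show "\<bar>(g z (x + s) - g z x) / s\<bar> \<le> K * sin (pi * z)"
      using \<open>s \<noteq> 0\<close> by (simp add: field_simps)
  qed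
  have "((\<lambda>s. (drift h (x + s) - drift h x) / s) \<longlongrightarrow>
     1 / (2 * pi) * (LINT z:{0..1}|lborel. cot (pi * z) * g' z x)) (at 0)"
    unfolding tendsto_at_iff_sequentially comp_def
  proof (intro allI impI)
    fix S :: "nat \<Rightarrow> real"
    assume S: "\<forall>i. S i \<in> UNIV - {0}" and lim: "S \<longlonglongrightarrow> 0"
    have eq: "(drift h (x + S i) - drift h x) / S i =
       1 / (2 * pi) * (LINT z:{0..1}|lborel. cot (pi * z) * ((g z (x + S i) - g z x) / S i))" for i
    proof -
      have "(LINT z:{0..1}|lborel. cot (pi * z) * ((g z (x + S i) - g z x) / S i))
        = (LINT z:{0..1}|lborel. (cot (pi * z) * g z (x + S i) - cot (pi * z) * g z x) / S i)"
        by (simp add: right_diff_distrib)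
      also have "\<dots> = ((LINT z:{0..1}|lborel. cot (pi * z) * g z (x + S i)) -
          (LINT z:{0..1}|lborel. cot (pi * z) * g z x)) / S i"
        by (subst set_integral_divide_zero, subst set_integral_diff(2)[OF int int]) simp
      finally show ?thesis
        by (simp add: drift_def g_def diff_divide_distrib right_diff_distrib)
    qed
    have "(\<lambda>i. LINT z:{0..1}|lborel. cot (pi * z) * ((g z (x + S i) - g z x) / S i))
       \<longlonglongrightarrow> (LINT z:{0..1}|lborel. cot (pi * z) * g' z x)"
      unfolding set_lebesgue_integral_def
    proof (rule integral_dominated_convergence)
      show "integrable lborel (\<lambda>z. indicator {0..1::real} z *\<^sub>R K)" by simp
      show "AE z in lborel. (\<lambda>i. indicator {0..1} z *\<^sub>R (cot (pi * z) * ((g z (x + S i) - g z x) / S i)))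
          \<longlonglongrightarrow> indicator {0..1} z *\<^sub>R (cot (pi * z) * g' z x)"
      proof (intro AE_I2 tendsto_intros)
        fix z
        have "((\<lambda>s. (g z (x + s) - g z x) / s) \<longlongrightarrow> g' z x) (at 0)"
          using gD by (simp add: DERIV_def)
        then show "(\<lambda>i. (g z (x + S i) - g z x) / S i) \<longlonglongrightarrow> g' z x"
          using S lim unfolding tendsto_at_iff_sequentially comp_def by blast
      qed
      show "AE z in lborel. norm (indicator {0..1} z *\<^sub>R (cot (pi * z) * ((g z (x + S i) - g z x) / S i)))
           \<le> indicator {0..1} z *\<^sub>R K" for i
        using quot[of _ "S i"] S by (intro AE_I2) (auto simp: indicator_def)
    qed (unfold g_def g'_def, measurable)
    then show "(\<lambda>i. (drift h (x + S i) - drift h x) / S i) \<longlonglongrightarrow>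
         1 / (2 * pi) * (LINT z:{0..1}|lborel. cot (pi * z) * g' z x)"
      unfolding eq by (intro tendsto_intros)
  qed
  then show ?thesis by (simp add: DERIV_def g'_def)
qed

definition drift_lip :: real where
  "drift_lip = (SUP x. \<bar>deriv (drift h) x\<bar>)"

lemma drift_lipschitz: "\<bar>drift h x - drift h y\<bar> \<le> drift_lip * \<bar>x - y\<bar>"
  and drift_lip_nonneg: "0 \<le> drift_lip"
proof -
  obtain K where K: "0 \<le> K" 
     "\<And>x z. z \<in> {0..1} \<Longrightarrow> \<bar>deriv h (x - z) - deriv h x\<bar> \<le> K * sin (pi * z)"
    using density_bounds by metis
  have bound: "\<bar>deriv (drift h) x\<bar> \<le> 1 / (2 * pi) * K" for x
  proof -
    have le: "\<bar>cot (pi * z) * (deriv h (x - z) - deriv h x)\<bar> \<le> K" if "z \<in> {0..1}" for z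
      using K that by (intro cot_times_increment_bounded) auto
    have "\<bar>LINT z:{0..1}|lborel. cot (pi * z) * (deriv h (x - z) - deriv h x)\<bar> \<le> K"
      using le by (intro abs_LINT_unit_interval_le) auto
    then show ?thesis
      unfolding DERIV_imp_deriv[OF DERIV_drift] abs_mult by (simp add: mult_left_mono divide_right_mono)
  qed
  have bdd: "bdd_above (range (\<lambda>x. \<bar>deriv (drift h) x\<bar>))"
    using bound by (intro bdd_aboveI[of _ "1 / (2 * pi) * K"]) auto
  have le: "\<bar>deriv (drift h) x\<bar> \<le> drift_lip" for x
    unfolding drift_lip_def by (intro cSUP_upper bdd) auto
  show "0 \<le> drift_lip" using le[of 0] abs_ge_zero[of "deriv (drift h) 0"] by linarith
  have "(drift h has_real_derivative deriv (drift h) z) (at z)" for z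
    using DERIV_drift[of z] DERIV_imp_deriv[OF DERIV_drift[of z]] by simp
  then show "\<bar>drift h x - drift h y\<bar> \<le> drift_lip * \<bar>x - y\<bar>"
    using field_differentiable_bound[of UNIV "drift h" "deriv (drift h)" drift_lip x y] le by auto
qed

section \<open>First and second moments of one displacement\<close>

text \<open>Since the displacement has integral zero over a period, \<open>h (x - z)\<close> may be replaced by
  \<open>h (x - z) - h x\<close> in the mean, and subtracting \<open>c * drift h x\<close> leaves the difference
  between the displacement and its cotangent approximation, integrated against that increment.\<close>
lemma slit_shift_moments:
  assumes \<sigma>: "\<sigma> \<in> {-1, 1}"
  obtains K where "0 \<le> K"
    "\<And>c x. 0 < c \<Longrightarrow> c \<le> 1 \<Longrightarrow>
       \<bar>(LINT y:{0..1}|lborel. slit_shift \<sigma> c (x - y) * h y) - c * drift h x\<bar> \<le> K * (c * sqrt c)"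
    "\<And>c x. 0 < c \<Longrightarrow> c \<le> 1 \<Longrightarrow>
       (LINT y:{0..1}|lborel. (slit_shift \<sigma> c (x - y))\<^sup>2 * h y) \<le> K * (c * sqrt c)"
proof -
  obtain K where K: "0 \<le> K" "\<And>x. \<bar>h x\<bar> \<le> K"
    "\<And>x z. z \<in> {0..1} \<Longrightarrow> \<bar>h (x - z) - h x\<bar> \<le> K * sin (pi * z)"
    using density_bounds by metis
  have h_shift: "h (x - (z + 1)) = h (x - z)" for x z
    using density_periodic[of "x - (z + 1)"] by simp
  have first: "\<bar>(LINT y:{0..1}|lborel. slit_shift \<sigma> c (x - y) * h y) - c * drift h x\<bar> \<le> 2 * K * (c * sqrt c)"
    and second: "(LINT y:{0..1}|lborel. (slit_shift \<sigma> c (x - y))\<^sup>2 * h y) \<le> 2 * K * (c * sqrt c)"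
    if c: "0 < c" "c \<le> 1" for c x
  proof -
    define P where "P = slit_shift \<sigma> c"
    have [measurable]: "P \<in> borel_measurable borel" by (simp add: P_def)
    have P1: "\<bar>P z\<bar> \<le> 1" for z using abs_slit_shift_le_one[of c \<sigma> z] c \<sigma> by (simp add: P_def)
    have Pper: "P (z + 1) = P z" for z by (simp add: P_def slit_shift_periodic)
    have reflect: "(LINT y:{0..1}|lborel. g (P (x - y)) * h y) = (LINT z:{0..1}|lborel. g (P z) * h (x - z))"
      if [measurable]: "g \<in> borel_measurable borel" and g: "\<And>p. \<bar>p\<bar> \<le> 1 \<Longrightarrow> \<bar>g p\<bar> \<le> 1" for g :: "real \<Rightarrow> real"
    proof -
      have "\<bar>g (P z) * h (x - z)\<bar> \<le> 1 * K" for z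
        unfolding abs_mult using g[OF P1] K by (intro mult_mono) auto
      then have "(LINT y:{0..1}|lborel. g (P (x - y)) * h (x - (x - y))) = (LINT z:{0..1}|lborel. g (P z) * h (x - z))"
        by (intro LINT_periodic_reflect[where f="\<lambda>z. g (P z) * h (x - z)"]) (auto simp: Pper h_shift)
      then show ?thesis by simp
    qed
    have PK: "\<bar>P z * u\<bar> \<le> C" if "\<bar>u\<bar> \<le> C" for z u C
    proof -
      have "\<bar>P z\<bar> * \<bar>u\<bar> \<le> 1 * C" using that P1 by (intro mult_mono) auto
      then show ?thesis by (simp add: abs_mult)
    qed
    have int1: "set_integrable lborel {0..1} (\<lambda>z. P z * h (x - z))"
      and int2: "set_integrable lborel {0..1} (\<lambda>z. P z * h x)"
      using K by (auto intro!: set_integrable_Icc_bounded[where C=K] PK)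
    have int4: "set_integrable lborel {0..1} (\<lambda>z. c / (2 * pi) * (cot (pi * z) * (h (x - z) - h x)))"
      using K by (intro set_integrable_mult_right set_integrable_Icc_bounded[where C=K]
          cot_times_increment_bounded) auto
    have zero: "(LINT z:{0..1}|lborel. P z) = 0"
      by (rule LINT_antisymmetric_zero) (auto simp: P_def slit_shift_reflect)
    have "(LINT y:{0..1}|lborel. P (x - y) * h y) - c * drift h x =
        (LINT z:{0..1}|lborel. P z * h (x - z)) - (LINT z:{0..1}|lborel. P z * h x)
          - (LINT z:{0..1}|lborel. c / (2 * pi) * (cot (pi * z) * (h (x - z) - h x)))"
      using reflect[of "\<lambda>p. p"] by (simp add: zero drift_def)
    also have "\<dots> = (LINT z:{0..1}|lborel. P z * h (x - z) - P z * h x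
         - c / (2 * pi) * (cot (pi * z) * (h (x - z) - h x)))"
      using int1 int2 int4 by simp
    also have "\<dots> = (LINT z:{0..1}|lborel. 1 / pi * ((pi * P z - c / 2 * cot (pi * z)) * (h (x - z) - h x)))"
    proof -
      have "p * a - p * b - c / (2 * pi) * (k * (a - b)) = 1 / pi * ((pi * p - c / 2 * k) * (a - b))"
        for p a b k by (simp add: field_simps)
      then show ?thesis by (simp only:)
    qed
    finally have eq: "(LINT y:{0..1}|lborel. P (x - y) * h y) - c * drift h x = \<dots>" .
    have "\<bar>1 / pi * ((pi * P z - c / 2 * cot (pi * z)) * (h (x - z) - h x))\<bar> \<le> K * slit_kernel c z"
      if z: "0 < z" "z < 1" for z
    proof -
      have "\<bar>1 / pi * ((pi * P z - c / 2 * cot (pi * z)) * (h (x - z) - h x))\<bar>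
          \<le> 1 * (\<bar>pi * P z - c / 2 * cot (pi * z)\<bar> * (K * sin (pi * z)))"
        unfolding abs_mult using K z pi_gt3 by (intro mult_mono) auto
      also have "\<dots> = K * (sin (pi * z) * \<bar>pi * P z - c / 2 * cot (pi * z)\<bar>)" by simp
      also have "\<dots> \<le> K * slit_kernel c z"
        using slit_shift_bounds(2)[OF z c] K unfolding P_def by (intro mult_left_mono) auto
      finally show ?thesis .
    qed
    from abs_LINT_le_slit_kernel[OF this c(1) K(1)]
    show "\<bar>(LINT y:{0..1}|lborel. slit_shift \<sigma> c (x - y) * h y) - c * drift h x\<bar> \<le> 2 * K * (c * sqrt c)"
      unfolding P_def[symmetric] eq .
    have "\<bar>(P z)\<^sup>2 * h (x - z)\<bar> \<le> K * slit_kernel c z" if z: "0 < z" "z < 1" for z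
    proof -
      have "pi\<^sup>2 * (P z)\<^sup>2 \<le> 8 * slit_kernel c z"
        using slit_shift_bounds(1)[OF z c] unfolding P_def by (simp add: power_mult_distrib)
      moreover have "8 * (P z)\<^sup>2 \<le> pi\<^sup>2 * (P z)\<^sup>2"
        using power_mono[OF less_imp_le[OF pi_gt3], of 2] by (intro mult_right_mono) auto
      ultimately have "(P z)\<^sup>2 \<le> slit_kernel c z" by linarith
      then have "(P z)\<^sup>2 * \<bar>h (x - z)\<bar> \<le> slit_kernel c z * K"
        using K slit_kernel_nonneg[OF c(1)] by (intro mult_mono) auto
      then show ?thesis by (simp add: abs_mult mult.commute)
    qed
    from abs_LINT_le_slit_kernel[OF this c(1) K(1)]
    show "(LINT y:{0..1}|lborel. (slit_shift \<sigma> c (x - y))\<^sup>2 * h y) \<le> 2 * K * (c * sqrt c)"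
      unfolding P_def[symmetric] using reflect[of "\<lambda>p. p\<^sup>2"] by (auto simp: abs_square_le_1)
  qed
  from K(1) have "0 \<le> 2 * K" by simp
  then show ?thesis using first second by (rule that)
qed

text \<open>In the expansion of the square, the mean of the displacement and the increment \<open>q - p\<close> of the
  solution cancel to first order up to \<open>c * (drift h x - drift h p)\<close>, which the Lipschitz constant of
  the drift controls.  The cross term with the error of order \<open>c * sqrt c\<close> is linear in
  \<open>\<bar>x - p\<bar>\<close> and is absorbed by \<open>2 * \<bar>x - p\<bar> \<le> (x - p)\<^sup>2 + 1\<close>; everything else is quadratic
  in \<open>c\<close> or is the second moment of the displacement.  The constant is uniform in the position, in the capacity and in the step
  \<open>q - p\<close>.\<close>

lemma second_moment_step:
  assumes \<sigma>: "\<sigma> \<in> {-1, 1}"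
  obtains K where "0 \<le> K"
    "\<And>c p q x. 0 < c \<Longrightarrow> c \<le> 1 \<Longrightarrow> \<bar>q - p - c * drift h p\<bar> \<le> K0 * c\<^sup>2 \<Longrightarrow>
       (LINT y:{0..1}|lborel. (x + slit_shift \<sigma> c (x - y) - q)\<^sup>2 * h y)
         \<le> (1 + 2 * drift_lip * c + K * (c * sqrt c)) * (x - p)\<^sup>2 + K * (c * sqrt c)"
proof -
  obtain K1 where K1: "0 \<le> K1"
    "\<And>c x. 0 < c \<Longrightarrow> c \<le> 1 \<Longrightarrow>
       \<bar>(LINT y:{0..1}|lborel. slit_shift \<sigma> c (x - y) * h y) - c * drift h x\<bar> \<le> K1 * (c * sqrt c)"
    "\<And>c x. 0 < c \<Longrightarrow> c \<le> 1 \<Longrightarrow>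
       (LINT y:{0..1}|lborel. (slit_shift \<sigma> c (x - y))\<^sup>2 * h y) \<le> K1 * (c * sqrt c)"
    using slit_shift_moments[OF \<sigma>] by blast
  obtain B where B: "0 \<le> B" "\<And>x. \<bar>drift h x\<bar> \<le> B" using drift_bounded by metis
  obtain H where H: "0 \<le> H" "\<And>x. \<bar>h x\<bar> \<le> H" using density_bounds by metis
  define J where "J = \<bar>K0\<bar>"
  define K where "K = (K1 + J) + 2 * (B + J)\<^sup>2 + (B + K1)\<^sup>2 + K1"
  have le: "(LINT y:{0..1}|lborel. (x + slit_shift \<sigma> c (x - y) - q)\<^sup>2 * h y)
         \<le> (1 + 2 * drift_lip * c + K * (c * sqrt c)) * (x - p)\<^sup>2 + K * (c * sqrt c)"
    if c: "0 < c" "c \<le> 1" and q: "\<bar>q - p - c * drift h p\<bar> \<le> K0 * c\<^sup>2" for c p q x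
  proof -
    define P where "P y = slit_shift \<sigma> c (x - y)" for y
    have [measurable]: "P \<in> borel_measurable borel" unfolding P_def[abs_def] by measurable
    have P1: "\<bar>P y\<bar> \<le> 1" for y using abs_slit_shift_le_one[of c \<sigma> "x - y"] c \<sigma> by (simp add: P_def)
    have int: "set_integrable lborel {0..1} (\<lambda>y. g (P y) * h y)"
      if [measurable]: "g \<in> borel_measurable borel" and g: "\<And>p. \<bar>p\<bar> \<le> 1 \<Longrightarrow> \<bar>g p\<bar> \<le> 1" for g :: "real \<Rightarrow> real"
    proof (rule set_integrable_Icc_bounded)
      show "\<bar>g (P y) * h y\<bar> \<le> 1 * H" for y
        unfolding abs_mult using g[OF P1] H by (intro mult_mono) auto
    qed simp
    define m1 m2 where "m1 = (LINT y:{0..1}|lborel. P y * h y)"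
      and "m2 = (LINT y:{0..1}|lborel. (P y)\<^sup>2 * h y)"
    define r D \<delta> where "r = c * sqrt c" and "D = x - p" and "\<delta> = q - p"
    have r0: "0 \<le> r" and cr: "c\<^sup>2 \<le> r" and r1: "r \<le> c"
    proof -
      have "c \<le> sqrt c" using c by (intro real_le_rsqrt) (simp add: power2_eq_square mult_left_le)
      then show "c\<^sup>2 \<le> r" using c by (simp add: r_def power2_eq_square)
    qed (use c in \<open>auto simp: r_def mult_left_le\<close>)
    have m1: "\<bar>m1 - c * drift h x\<bar> \<le> K1 * r" and m2: "m2 \<le> K1 * r"
      using K1(2,3)[OF c, of x] by (simp_all add: m1_def m2_def P_def r_def)
    have "(LINT y:{0..1}|lborel. (x + P y - q)\<^sup>2 * h y)
       = (LINT y:{0..1}|lborel. (D - \<delta>)\<^sup>2 * h y + 2 * (D - \<delta>) * (P y * h y) + (P y)\<^sup>2 * h y)"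
    proof -
      have "(x + w - q)\<^sup>2 * u = (D - \<delta>)\<^sup>2 * u + 2 * (D - \<delta>) * (w * u) + w\<^sup>2 * u" for w u
        unfolding D_def \<delta>_def by algebra
      then show ?thesis by (simp only:)
    qed
    also have "\<dots> = (D - \<delta>)\<^sup>2 + 2 * (D - \<delta>) * m1 + m2"
    proof -
      have i0: "set_integrable lborel {0..1} (\<lambda>y. (D - \<delta>)\<^sup>2 * h y)"
        using density by (auto simp: circle_density_def)
      have i1: "set_integrable lborel {0..1} (\<lambda>y. 2 * (D - \<delta>) * (P y * h y))"
        using int[of "\<lambda>p. p"] by auto
      have i2: "set_integrable lborel {0..1} (\<lambda>y. (P y)\<^sup>2 * h y)"
        using int[of "\<lambda>p. p\<^sup>2"] by (auto simp: abs_square_le_1)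
      show ?thesis
        by (subst set_integral_add(2)[OF set_integral_add(1)[OF i0 i1] i2], subst set_integral_add(2)[OF i0 i1])
          (simp add: m1_def m2_def density_integral)
    qed
    also have "\<dots> = D\<^sup>2 + 2 * (D * (m1 - \<delta>)) + (\<delta>\<^sup>2 - 2 * \<delta> * m1 + m2)"
      by algebra
    also have "\<dots> \<le> D\<^sup>2 + (2 * drift_lip * c * D\<^sup>2 + (K1 + J) * r * (D\<^sup>2 + 1))
        + (2 * (B + J)\<^sup>2 * r + (B + K1)\<^sup>2 * r + K1 * r)"
    proof (rule add_mono[OF add_mono[OF order_refl]])
      have qJ: "\<bar>\<delta> - c * drift h p\<bar> \<le> J * c\<^sup>2"
        using q mult_right_mono[OF abs_ge_self[of K0], of "c\<^sup>2"] by (simp add: \<delta>_def J_def)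
      then have qr: "\<bar>\<delta> - c * drift h p\<bar> \<le> J * r"
        using mult_left_mono[OF cr, of J] by (simp add: J_def)
      have "\<bar>c * drift h x - c * drift h p\<bar> \<le> c * (drift_lip * \<bar>D\<bar>)"
        using drift_lipschitz[of x p] c
        by (simp add: D_def right_diff_distrib[symmetric] abs_mult)
      with qr m1 have "\<bar>m1 - \<delta>\<bar> \<le> c * (drift_lip * \<bar>D\<bar>) + (K1 + J) * r"
        by (simp add: distrib_right)
      then have "\<bar>D\<bar> * \<bar>m1 - \<delta>\<bar> \<le> \<bar>D\<bar> * (c * (drift_lip * \<bar>D\<bar>) + (K1 + J) * r)"
        by (intro mult_left_mono) auto
      also have "\<dots> = drift_lip * c * D\<^sup>2 + (K1 + J) * r * \<bar>D\<bar>"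
      proof -
        have "\<bar>D\<bar> * \<bar>D\<bar> = D\<^sup>2" by (simp add: power2_eq_square)
        then show ?thesis by algebra
      qed
      finally have "2 * (D * (m1 - \<delta>)) \<le> 2 * drift_lip * c * D\<^sup>2 + (K1 + J) * r * (2 * \<bar>D\<bar>)"
        using abs_ge_self[of "D * (m1 - \<delta>)"] by (simp add: abs_mult)
      also have "(K1 + J) * r * (2 * \<bar>D\<bar>) \<le> (K1 + J) * r * (D\<^sup>2 + 1)"
      proof (intro mult_left_mono)
        have "0 \<le> (\<bar>D\<bar> - 1)\<^sup>2" by simp
        then show "2 * \<bar>D\<bar> \<le> D\<^sup>2 + 1" by (simp add: power2_diff)
      qed (use K1 r0 in \<open>auto simp: J_def\<close>)
      finally show "2 * (D * (m1 - \<delta>)) \<le> 2 * drift_lip * c * D\<^sup>2 + (K1 + J) * r * (D\<^sup>2 + 1)"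
        by simp
      have cB: "\<bar>c * drift h z\<bar> \<le> c * B" for z using B(2)[of z] c by (simp add: abs_mult)
      have "J * r \<le> c * J" using r1 by (simp add: J_def mult_left_mono mult.commute[of c])
      with qr cB[of p] have \<delta>: "\<bar>\<delta>\<bar> \<le> c * (B + J)" by (simp add: distrib_left)
      have "K1 * r \<le> c * K1" using r1 K1 by (simp add: mult_left_mono mult.commute[of c])
      with m1 cB[of x] have m1': "\<bar>m1\<bar> \<le> c * (B + K1)" by (simp add: distrib_left)
      have sq: "u\<^sup>2 \<le> v\<^sup>2 * r" if "\<bar>u\<bar> \<le> c * v" for u v
      proof -
        have "u\<^sup>2 \<le> (c * v)\<^sup>2" using power_mono[OF that, of 2] by simp
        also have "\<dots> \<le> v\<^sup>2 * r" using mult_left_mono[OF cr, of "v\<^sup>2"] by (simp add: power_mult_distrib mult.commute)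
        finally show ?thesis .
      qed
      have "- (2 * \<delta> * m1) \<le> \<delta>\<^sup>2 + m1\<^sup>2"
        using zero_le_power2[of "\<delta> + m1"] by (simp add: power2_sum)
      then show "\<delta>\<^sup>2 - 2 * \<delta> * m1 + m2 \<le> 2 * (B + J)\<^sup>2 * r + (B + K1)\<^sup>2 * r + K1 * r"
        using sq[OF \<delta>] sq[OF m1'] m2 by linarith
    qed
    also have "\<dots> \<le> (1 + 2 * drift_lip * c + K * r) * D\<^sup>2 + K * r"
    proof -
      have "0 \<le> (2 * (B + J)\<^sup>2 + (B + K1)\<^sup>2 + K1) * (r * D\<^sup>2)"
        using K1 r0 by (intro mult_nonneg_nonneg add_nonneg_nonneg) auto
      then show ?thesis by (simp add: K_def algebra_simps)
    qed
    finally show ?thesis by (simp add: P_def r_def D_def)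
  qed
  have "0 \<le> K" using K1 by (simp add: K_def J_def)
  then show ?thesis using le by (rule that)
qed

end

section \<open>A maximal inequality for the flow\<close>

text \<open>Fubini's theorem for independent variables, in the form in which it replaces conditioning on
  \<open>Y\<close>.\<close>

lemma (in prob_space) indep_var_nn_integral_le:
  assumes ind: "indep_var S Y T Z"
    and g [measurable]: "g \<in> borel_measurable (S \<Otimes>\<^sub>M T)"
    and k [measurable]: "k \<in> borel_measurable S"
    and le: "\<And>y. y \<in> space S \<Longrightarrow> (\<integral>\<^sup>+ z. g (y, z) \<partial>distr M T Z) \<le> k y"
  shows "(\<integral>\<^sup>+ \<omega>. g (Y \<omega>, Z \<omega>) \<partial>M) \<le> (\<integral>\<^sup>+ \<omega>. k (Y \<omega>) \<partial>M)"
proof -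
  have [measurable]: "Y \<in> measurable M S" "Z \<in> measurable M T"
    and joint: "distr M S Y \<Otimes>\<^sub>M distr M T Z = distr M (S \<Otimes>\<^sub>M T) (\<lambda>\<omega>. (Y \<omega>, Z \<omega>))"
    using ind unfolding indep_var_distribution_eq by auto
  interpret Z: prob_space "distr M T Z" by (rule prob_space_distr) measurable
  have "(\<integral>\<^sup>+ \<omega>. g (Y \<omega>, Z \<omega>) \<partial>M) = integral\<^sup>N (distr M S Y \<Otimes>\<^sub>M distr M T Z) g"
    unfolding joint by (subst nn_integral_distr) auto
  also have "\<dots> = (\<integral>\<^sup>+ y. \<integral>\<^sup>+ z. g (y, z) \<partial>distr M T Z \<partial>distr M S Y)"
    by (rule Z.nn_integral_fst[symmetric]) measurable
  also have "\<dots> \<le> (\<integral>\<^sup>+ y. k y \<partial>distr M S Y)"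
    using le by (intro nn_integral_mono) auto
  also have "\<dots> = (\<integral>\<^sup>+ \<omega>. k (Y \<omega>) \<partial>M)"
    by (subst nn_integral_distr) auto
  finally show ?thesis .
qed

text \<open>Ville's inequality.  The supermartingale property is only required on the events that the level
  has not been exceeded before, and in the integrated form, so that no conditional expectations
  occur.  The quantity \<open>Q n\<close> in the proof is the expectation of the process stopped at the first
  exceedance, with the value there replaced by its lower bound \<open>lev\<close>.\<close>
lemma (in prob_space) stopped_maximal_inequality:
  fixes V :: "nat \<Rightarrow> 'a \<Rightarrow> real"
  assumes meas [measurable]: "\<And>n. n \<le> N \<Longrightarrow> V n \<in> borel_measurable M"
    and lev: "0 < lev"
    and step: "\<And>n. n < N \<Longrightarrow>
      (\<integral>\<^sup>+ \<omega>. indicator {\<omega>\<in>space M. \<forall>j\<le>n. V j \<omega> \<le> lev} \<omega> * ennreal (V (Suc n) \<omega>) \<partial>M)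
       \<le> (\<integral>\<^sup>+ \<omega>. indicator {\<omega>\<in>space M. \<forall>j\<le>n. V j \<omega> \<le> lev} \<omega> * ennreal (V n \<omega>) \<partial>M)"
  shows "ennreal lev * emeasure M {\<omega>\<in>space M. \<exists>j\<le>N. lev < V j \<omega>} \<le> (\<integral>\<^sup>+ \<omega>. ennreal (V 0 \<omega>) \<partial>M)"
proof -
  define G where "G n = {\<omega>\<in>space M. \<forall>j\<le>n. V j \<omega> \<le> lev}" for n
  define Q where "Q n = ennreal lev * emeasure M (space M - G n)
       + (\<integral>\<^sup>+ \<omega>. indicator (G n) \<omega> * ennreal (V n \<omega>) \<partial>M)" for n
  have G [measurable]: "G n \<in> sets M" if "n \<le> N" for n
  proof -
    have "G n = (\<Inter>j\<in>{..n}. {\<omega>\<in>space M. V j \<omega> \<le> lev})" by (auto simp: G_def)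
    moreover have "{\<omega>\<in>space M. V j \<omega> \<le> lev} \<in> sets M" if "j \<in> {..n}" for j
      using meas[of j] that \<open>n \<le> N\<close> by simp
    ultimately show ?thesis by (auto intro!: sets.finite_INT)
  qed
  have Q_Suc: "Q (Suc n) \<le> Q n" if n: "n < N" for n
  proof -
    have [measurable]: "G n \<in> sets M" "G (Suc n) \<in> sets M" "V (Suc n) \<in> borel_measurable M"
      using G meas n by auto
    have sub: "G (Suc n) \<subseteq> G n" by (auto simp: G_def)
    have GS: "G n \<subseteq> space M" by (auto simp: G_def)
    have "emeasure M (space M - G (Suc n)) = emeasure M ((space M - G n) \<union> (G n - G (Suc n)))"
      using sub GS by (intro arg_cong[where f="emeasure M"]) auto
    also have "\<dots> = emeasure M (space M - G n) + emeasure M (G n - G (Suc n))"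
      by (intro plus_emeasure[symmetric]) auto
    finally have "Q (Suc n) = ennreal lev * emeasure M (space M - G n) +
        (ennreal lev * emeasure M (G n - G (Suc n)) + (\<integral>\<^sup>+ \<omega>. indicator (G (Suc n)) \<omega> * ennreal (V (Suc n) \<omega>) \<partial>M))"
      by (simp add: Q_def distrib_left add.assoc)
    also have "ennreal lev * emeasure M (G n - G (Suc n)) = (\<integral>\<^sup>+ \<omega>. ennreal lev * indicator (G n - G (Suc n)) \<omega> \<partial>M)"
      by (simp add: nn_integral_cmult)
    also have "\<dots> + (\<integral>\<^sup>+ \<omega>. indicator (G (Suc n)) \<omega> * ennreal (V (Suc n) \<omega>) \<partial>M)
       = (\<integral>\<^sup>+ \<omega>. ennreal lev * indicator (G n - G (Suc n)) \<omega> + indicator (G (Suc n)) \<omega> * ennreal (V (Suc n) \<omega>) \<partial>M)"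
      by (rule nn_integral_add[symmetric]) auto
    also have "\<dots> \<le> (\<integral>\<^sup>+ \<omega>. indicator (G n) \<omega> * ennreal (V (Suc n) \<omega>) \<partial>M)"
    proof (intro nn_integral_mono)
      fix \<omega>
      have "lev < V (Suc n) \<omega>" if "\<omega> \<in> G n" "\<omega> \<notin> G (Suc n)"
        using that by (auto simp: G_def not_le le_Suc_eq)
      then show "ennreal lev * indicator (G n - G (Suc n)) \<omega> + indicator (G (Suc n)) \<omega> * ennreal (V (Suc n) \<omega>)
         \<le> indicator (G n) \<omega> * ennreal (V (Suc n) \<omega>)"
        using sub by (auto simp: indicator_def intro!: ennreal_leI)
    qed
    also have "\<dots> \<le> (\<integral>\<^sup>+ \<omega>. indicator (G n) \<omega> * ennreal (V n \<omega>) \<partial>M)"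
      using step[OF n] by (simp add: G_def)
    finally show ?thesis by (simp add: Q_def add_left_mono)
  qed
  have "n \<le> N \<Longrightarrow> Q n \<le> Q 0" for n
  proof (induction n)
    case (Suc n)
    then show ?case using order_trans[OF Q_Suc[of n]] by simp
  qed simp
  then have "Q N \<le> Q 0" by simp
  also have "Q 0 \<le> (\<integral>\<^sup>+ \<omega>. ennreal (V 0 \<omega>) \<partial>M)"
  proof -
    have [measurable]: "G 0 \<in> sets M" "V 0 \<in> borel_measurable M" using G meas by auto
    have "ennreal lev * emeasure M (space M - G 0) = (\<integral>\<^sup>+ \<omega>. ennreal lev * indicator (space M - G 0) \<omega> \<partial>M)"
      by (simp add: nn_integral_cmult)
    then have "Q 0 = (\<integral>\<^sup>+ \<omega>. ennreal lev * indicator (space M - G 0) \<omega> + indicator (G 0) \<omega> * ennreal (V 0 \<omega>) \<partial>M)"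
      unfolding Q_def by (subst nn_integral_add) auto
    also have "\<dots> \<le> (\<integral>\<^sup>+ \<omega>. ennreal (V 0 \<omega>) \<partial>M)"
      by (intro nn_integral_mono) (auto simp: G_def indicator_def intro!: ennreal_leI)
    finally show ?thesis .
  qed
  finally have "Q N \<le> (\<integral>\<^sup>+ \<omega>. ennreal (V 0 \<omega>) \<partial>M)" .
  moreover have "{\<omega>\<in>space M. \<exists>j\<le>N. lev < V j \<omega>} = space M - G N" by (auto simp: G_def not_le)
  moreover have "ennreal lev * emeasure M (space M - G N) \<le> Q N" unfolding Q_def by simp
  ultimately show ?thesis by (simp add: order_trans)
qed

lemma harmonic_flow_cong:
  assumes "\<And>i. i \<in> {1..n} \<Longrightarrow> \<tau> i = \<tau>' i"
  shows "harmonic_flow \<sigma> c \<tau> n x = harmonic_flow \<sigma> c \<tau>' n x"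
  using assms by (induction n) auto

lemma measurable_harmonic_flow:
  assumes "{1..n} \<subseteq> I"
  shows "(\<lambda>\<tau>. harmonic_flow \<sigma> c \<tau> n x) \<in> borel_measurable (PiM I (\<lambda>_. borel))"
  using assms
proof (induction n)
  case (Suc n)
  then have [measurable]: "(\<lambda>\<tau>. harmonic_flow \<sigma> c \<tau> n x) \<in> borel_measurable (PiM I (\<lambda>_. borel))"
    by (simp add: subset_iff)
  have [measurable]: "(\<lambda>\<tau>. \<tau> (Suc n)) \<in> borel_measurable (PiM I (\<lambda>_. borel))"
    using Suc.prems by (intro measurable_component_singleton) auto
  show ?case by simp
qed simp

lemma harmonic_flow_Suc_shift:
  "harmonic_flow \<sigma> c \<tau> (Suc n) x =
     harmonic_flow \<sigma> c \<tau> n x + slit_shift \<sigma> c (harmonic_flow \<sigma> c \<tau> n x - \<tau> (Suc n))"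
  by (simp add: slit_shift_def)

text \<open>The bound that \<open>m\<close> iterations of the recursion \<open>u \<mapsto> (1 + a) * u + d\<close> give for the second moment of
  a deviation that is now \<open>y\<close>, slightly enlarged for the sake of a simple formula.  Evaluated with the
  number \<open>m\<close> of remaining steps it does not increase in mean along the flow.\<close>
definition potential :: "real \<Rightarrow> real \<Rightarrow> nat \<Rightarrow> real \<Rightarrow> real" where
  "potential a d m y = (1 + a) ^ m * (y\<^sup>2 + real m * d)"

lemma potential_ge_square:
  assumes "0 \<le> a" "0 \<le> d" shows "y\<^sup>2 \<le> potential a d m y"
proof -
  have "1 * (y\<^sup>2 + 0) \<le> (1 + a) ^ m * (y\<^sup>2 + real m * d)"
    using assms by (intro mult_mono add_mono) auto
  then show ?thesis by (simp add: potential_def)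
qed

text \<open>The deviation of the flow from an arbitrary deterministic sequence \<open>p\<close>.  The position after \<open>n\<close> steps
  is a function of the first \<open>n\<close> angles only and is hence independent of the next one; averaging over
  that angle alone turns the one-step bound into the supermartingale property of the potential.\<close>
lemma (in prob_space) flow_maximal_inequality:
  fixes \<theta> :: "nat \<Rightarrow> 'a \<Rightarrow> real" and p :: "nat \<Rightarrow> real" and \<mu> :: "real measure"
  assumes ind: "indep_vars (\<lambda>_. borel) \<theta> {1..}"
    and dist: "\<And>n. n \<ge> 1 \<Longrightarrow> distr M borel (\<theta> n) = \<mu>"
    and a: "0 \<le> a" and d: "0 \<le> d" and \<epsilon>: "0 < \<epsilon>" and p0: "p 0 = x"
    and step: "\<And>n y. n < N \<Longrightarrow>
        (\<integral>\<^sup>+ z. ennreal ((y + slit_shift \<sigma> c (y - z) - p (Suc n))\<^sup>2) \<partial>\<mu>) \<le> ennreal ((1 + a) * (y - p n)\<^sup>2 + d)"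
  shows "{\<omega>\<in>space M. \<exists>n\<le>N. \<epsilon> < \<bar>harmonic_flow \<sigma> c (\<lambda>i. \<theta> i \<omega>) n x - p n\<bar>} \<in> sets M"
    and "prob {\<omega>\<in>space M. \<exists>n\<le>N. \<epsilon> < \<bar>harmonic_flow \<sigma> c (\<lambda>i. \<theta> i \<omega>) n x - p n\<bar>}
            \<le> (1 + a) ^ N * (real N * d) / \<epsilon>\<^sup>2"
proof -
  define X where "X n \<omega> = harmonic_flow \<sigma> c (\<lambda>i. \<theta> i \<omega>) n x" for n \<omega>
  define V where "V n \<omega> = potential a d (N - n) (X n \<omega> - p n)" for n \<omega>
  have \<theta>_meas: "\<theta> n \<in> borel_measurable M" if "n \<ge> 1" for n
    using ind that unfolding indep_vars_def by auto
  have restr: "X n \<omega> = harmonic_flow \<sigma> c (restrict (\<lambda>i. \<theta> i \<omega>) {1..m}) n x" if "n \<le> m" for n m \<omega>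
    unfolding X_def using that by (intro harmonic_flow_cong) auto
  have X_meas [measurable]: "X n \<in> borel_measurable M" for n
  proof (induction n)
    case 0 then show ?case by (simp add: X_def)
  next
    case (Suc n)
    then have [measurable]: "(\<lambda>\<omega>. harmonic_flow \<sigma> c (\<lambda>i. \<theta> i \<omega>) n x) \<in> borel_measurable M"
      by (simp add: X_def[abs_def])
    have [measurable]: "\<theta> (Suc n) \<in> borel_measurable M" by (intro \<theta>_meas) auto
    show ?case unfolding X_def by simp
  qed
  have V_meas [measurable]: "V n \<in> borel_measurable M" for n
    unfolding V_def[abs_def] potential_def by measurable
  have \<epsilon>2: "0 < \<epsilon>\<^sup>2" using \<epsilon> by simp
  have max: "ennreal (\<epsilon>\<^sup>2) * emeasure M {\<omega>\<in>space M. \<exists>j\<le>N. \<epsilon>\<^sup>2 < V j \<omega>} \<le> (\<integral>\<^sup>+ \<omega>. ennreal (V 0 \<omega>) \<partial>M)"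
  proof (rule stopped_maximal_inequality[OF V_meas \<epsilon>2])
    fix n assume n: "n < N"
    define S where "S = PiM {1..n} (\<lambda>_. borel :: real measure)"
    define F where "F j \<tau> = harmonic_flow \<sigma> c \<tau> j x" for j \<tau>
    define R where "R \<tau> \<longleftrightarrow> (\<forall>j\<in>{..n}. potential a d (N - j) (F j \<tau> - p j) \<le> \<epsilon>\<^sup>2)" for \<tau>
    have F_meas: "F j \<in> borel_measurable S" if "j \<le> n" for j
      unfolding F_def[abs_def] S_def using that by (intro measurable_harmonic_flow) auto
    have [measurable]: "F n \<in> borel_measurable S" by (simp add: F_meas)
    have [measurable]: "Measurable.pred S R"
      unfolding R_def potential_def using F_meas
      by (intro pred_intros_finite) (auto intro!: measurable_sets)
    define Y where "Y \<omega> = restrict (\<lambda>i. \<theta> i \<omega>) {1..n}" for \<omega>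
    have XF: "X j \<omega> = F j (Y \<omega>)" if "j \<le> n" for j \<omega>
      unfolding F_def Y_def using restr[OF that] .
    define T where "T = PiM {Suc n} (\<lambda>_. borel :: real measure)"
    define Z where "Z \<omega> = restrict (\<lambda>i. \<theta> i \<omega>) {Suc n}" for \<omega>
    have indep: "indep_var S Y T Z"
      unfolding S_def T_def Y_def[abs_def] Z_def[abs_def] by (rule indep_var_restrict[OF ind]) auto
    then have [measurable]: "Z \<in> measurable M T" unfolding indep_var_distribution_eq by auto
    have [measurable]: "(\<lambda>\<tau>. \<tau> (Suc n)) \<in> borel_measurable T"
      unfolding T_def by (intro measurable_component_singleton) auto
    have dist': "distr M borel (\<theta> (Suc n)) = \<mu>" using dist by simp
    have Z_distr: "(\<integral>\<^sup>+ \<tau>. f (\<tau> (Suc n)) \<partial>distr M T Z) = (\<integral>\<^sup>+ z. f z \<partial>\<mu>)"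
      if [measurable]: "f \<in> borel_measurable borel" for f :: "real \<Rightarrow> ennreal"
    proof -
      have [measurable]: "\<theta> (Suc n) \<in> borel_measurable M" by (intro \<theta>_meas) auto
      show ?thesis unfolding dist'[symmetric] by (simp add: nn_integral_distr Z_def)
    qed
    interpret mu: prob_space \<mu>
      unfolding dist'[symmetric] by (intro prob_space_distr \<theta>_meas) auto
    have sets_mu [measurable_cong]: "sets \<mu> = sets borel" by (simp flip: dist')
    define m where "m = N - Suc n"
    have m: "N - n = Suc m" using n by (simp add: m_def)
    define g where "g = (\<lambda>(\<tau>, \<zeta>). of_bool (R \<tau>) *
        ennreal (potential a d m (F n \<tau> + slit_shift \<sigma> c (F n \<tau> - \<zeta> (Suc n)) - p (Suc n))))"
    define k where "k \<tau> = of_bool (R \<tau>) * ennreal (potential a d (Suc m) (F n \<tau> - p n))" for \<tau>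
    have "(\<integral>\<^sup>+ \<omega>. g (Y \<omega>, Z \<omega>) \<partial>M) \<le> (\<integral>\<^sup>+ \<omega>. k (Y \<omega>) \<partial>M)"
    proof (rule indep_var_nn_integral_le[OF indep])
      show "g \<in> borel_measurable (S \<Otimes>\<^sub>M T)" unfolding g_def potential_def of_bool_def by measurable
      show "k \<in> borel_measurable S" unfolding k_def[abs_def] potential_def of_bool_def by measurable
      fix \<tau>
      have "(\<integral>\<^sup>+ z. ennreal (potential a d m (y + slit_shift \<sigma> c (y - z) - p (Suc n))) \<partial>\<mu>)
         \<le> ennreal (potential a d (Suc m) (y - p n))" for y
      proof -
        define w where "w z = (y + slit_shift \<sigma> c (y - z) - p (Suc n))\<^sup>2" for z
        have [measurable]: "w \<in> borel_measurable borel" unfolding w_def[abs_def] by measurable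
        then have [measurable]: "w \<in> borel_measurable \<mu>" by (simp cong: measurable_cong_sets[OF sets_mu refl])
        have "(\<integral>\<^sup>+ z. ennreal (potential a d m (y + slit_shift \<sigma> c (y - z) - p (Suc n))) \<partial>\<mu>)
           = (\<integral>\<^sup>+ z. ennreal ((1 + a) ^ m) * (ennreal (w z) + ennreal (real m * d)) \<partial>\<mu>)"
        proof (intro nn_integral_cong)
          fix z
          have "ennreal (w z) + ennreal (real m * d) = ennreal (w z + real m * d)"
            using d by (subst ennreal_plus) (auto simp: w_def)
          moreover have "ennreal ((1 + a) ^ m) * ennreal (w z + real m * d)
              = ennreal ((1 + a) ^ m * (w z + real m * d))"
            using a d by (subst ennreal_mult) (auto simp: w_def)
          ultimately show "ennreal (potential a d m (y + slit_shift \<sigma> c (y - z) - p (Suc n)))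
              = ennreal ((1 + a) ^ m) * (ennreal (w z) + ennreal (real m * d))"
            by (simp add: potential_def w_def)
        qed
        also have "\<dots> = ennreal ((1 + a) ^ m) * ((\<integral>\<^sup>+ z. ennreal (w z) \<partial>\<mu>) + ennreal (real m * d))"
          by (subst nn_integral_cmult, simp, subst nn_integral_add) (simp_all add: mu.emeasure_space_1)
        also have "\<dots> \<le> ennreal ((1 + a) ^ m) * (ennreal ((1 + a) * (y - p n)\<^sup>2 + d) + ennreal (real m * d))"
          using step[OF n] unfolding w_def by (intro mult_left_mono add_right_mono) auto
        also have "\<dots> = ennreal ((1 + a) ^ m * ((1 + a) * (y - p n)\<^sup>2 + d + real m * d))"
          using a d by (subst ennreal_mult, simp, simp, subst ennreal_plus) (simp_all add: add_nonneg_nonneg)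
        also have "\<dots> \<le> ennreal (potential a d (Suc m) (y - p n))"
        proof (rule ennreal_leI)
          have "(1 + a) * (y - p n)\<^sup>2 + d + real m * d \<le> (1 + a) * ((y - p n)\<^sup>2 + real (Suc m) * d)"
            using mult_nonneg_nonneg[OF a, of "real (Suc m) * d"] d by (simp add: algebra_simps)
          from mult_left_mono[OF this, of "(1 + a) ^ m"] a
          show "(1 + a) ^ m * ((1 + a) * (y - p n)\<^sup>2 + d + real m * d) \<le> potential a d (Suc m) (y - p n)"
            by (simp add: potential_def mult_ac)
        qed
        finally show ?thesis .
      qed
      then show "(\<integral>\<^sup>+ \<zeta>. g (\<tau>, \<zeta>) \<partial>distr M T Z) \<le> k \<tau>"
        unfolding g_def k_def
        using Z_distr[of "\<lambda>z. ennreal (potential a d m (F n \<tau> + slit_shift \<sigma> c (F n \<tau> - z) - p (Suc n)))"]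
        by (cases "R \<tau>") (auto simp: potential_def)
    qed
    moreover have "g (Y \<omega>, Z \<omega>) = indicator {\<omega>\<in>space M. \<forall>j\<le>n. V j \<omega> \<le> \<epsilon>\<^sup>2} \<omega> * ennreal (V (Suc n) \<omega>)"
      and "k (Y \<omega>) = indicator {\<omega>\<in>space M. \<forall>j\<le>n. V j \<omega> \<le> \<epsilon>\<^sup>2} \<omega> * ennreal (V n \<omega>)" if \<omega>: "\<omega> \<in> space M" for \<omega>
    proof -
      have R: "R (Y \<omega>) \<longleftrightarrow> (\<forall>j\<le>n. V j \<omega> \<le> \<epsilon>\<^sup>2)"
        by (auto simp: R_def V_def XF)
      have "X (Suc n) \<omega> = X n \<omega> + slit_shift \<sigma> c (X n \<omega> - \<theta> (Suc n) \<omega>)"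
        unfolding X_def by (rule harmonic_flow_Suc_shift)
      then have "V (Suc n) \<omega> = potential a d m (F n (Y \<omega>) + slit_shift \<sigma> c (F n (Y \<omega>) - \<theta> (Suc n) \<omega>) - p (Suc n))"
        by (simp add: V_def m_def XF)
      then show "g (Y \<omega>, Z \<omega>) = indicator {\<omega>\<in>space M. \<forall>j\<le>n. V j \<omega> \<le> \<epsilon>\<^sup>2} \<omega> * ennreal (V (Suc n) \<omega>)"
        using \<omega> by (simp add: g_def R indicator_def Z_def)
      show "k (Y \<omega>) = indicator {\<omega>\<in>space M. \<forall>j\<le>n. V j \<omega> \<le> \<epsilon>\<^sup>2} \<omega> * ennreal (V n \<omega>)"
        using \<omega> by (simp add: k_def R indicator_def V_def m XF)
    qed
    ultimately show "(\<integral>\<^sup>+ \<omega>. indicator {\<omega>\<in>space M. \<forall>j\<le>n. V j \<omega> \<le> \<epsilon>\<^sup>2} \<omega> * ennreal (V (Suc n) \<omega>) \<partial>M)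
       \<le> (\<integral>\<^sup>+ \<omega>. indicator {\<omega>\<in>space M. \<forall>j\<le>n. V j \<omega> \<le> \<epsilon>\<^sup>2} \<omega> * ennreal (V n \<omega>) \<partial>M)"
      by (simp cong: nn_integral_cong)
  qed
  let ?B = "{\<omega>\<in>space M. \<exists>n\<le>N. \<epsilon> < \<bar>X n \<omega> - p n\<bar>}"
  have B_sets: "?B \<in> sets M" by measurable
  then show "{\<omega>\<in>space M. \<exists>n\<le>N. \<epsilon> < \<bar>harmonic_flow \<sigma> c (\<lambda>i. \<theta> i \<omega>) n x - p n\<bar>} \<in> sets M"
    unfolding X_def .
  have sub: "?B \<subseteq> {\<omega>\<in>space M. \<exists>j\<le>N. \<epsilon>\<^sup>2 < V j \<omega>}"
  proof safe
    fix \<omega> n assume n: "n \<le> N" and gt: "\<epsilon> < \<bar>X n \<omega> - p n\<bar>"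
    have "\<epsilon>\<^sup>2 < \<bar>X n \<omega> - p n\<bar>\<^sup>2" using gt \<epsilon> by (intro power_strict_mono) auto
    then have "\<epsilon>\<^sup>2 < V n \<omega>"
      using potential_ge_square[OF a d, of "X n \<omega> - p n" "N - n"] by (simp add: V_def)
    with n show "\<exists>j\<le>N. \<epsilon>\<^sup>2 < V j \<omega>" by blast
  qed
  have "ennreal (\<epsilon>\<^sup>2 * prob ?B) = ennreal (\<epsilon>\<^sup>2) * emeasure M ?B"
    by (simp add: emeasure_eq_measure ennreal_mult)
  also have "\<dots> \<le> ennreal (\<epsilon>\<^sup>2) * emeasure M {\<omega>\<in>space M. \<exists>j\<le>N. \<epsilon>\<^sup>2 < V j \<omega>}"
    using sub by (intro mult_left_mono emeasure_mono) auto
  also note max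
  also have "(\<integral>\<^sup>+ \<omega>. ennreal (V 0 \<omega>) \<partial>M) = ennreal ((1 + a) ^ N * (real N * d))"
    by (simp add: V_def X_def p0 potential_def emeasure_space_1)
  finally have "\<epsilon>\<^sup>2 * prob ?B \<le> (1 + a) ^ N * (real N * d)"
    using a d by (subst (asm) ennreal_le_iff) auto
  then show "prob {\<omega>\<in>space M. \<exists>n\<le>N. \<epsilon> < \<bar>harmonic_flow \<sigma> c (\<lambda>i. \<theta> i \<omega>) n x - p n\<bar>}
      \<le> (1 + a) ^ N * (real N * d) / \<epsilon>\<^sup>2"
    unfolding X_def[symmetric] using \<epsilon>2 by (simp add: pos_le_divide_eq mult.commute)
qed

section \<open>The error at the logarithmic time horizon\<close>

definition log_gap :: "real \<Rightarrow> real" where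
  "log_gap c = ln (inverse c) - 3 * ln (ln (inverse c))"

lemma log_gap_nonneg: "\<forall>\<^sub>F c in at_right 0. 0 \<le> log_gap c"
  unfolding log_gap_def by real_asymp

lemma sqrt_log_gap_tendsto_0: "((\<lambda>c. sqrt c * log_gap c) \<longlongrightarrow> 0) (at_right 0)"
  unfolding log_gap_def by real_asymp

lemma exp_half_log_gap_tendsto_0:
  "((\<lambda>c. exp (log_gap c / 2) * (sqrt c * log_gap c)) \<longlongrightarrow> 0) (at_right 0)"
  unfolding log_gap_def by real_asymp

text \<open>The factor \<open>4\<close> in the time horizon makes \<open>exp (2 * L * T c)\<close> equal to \<open>exp (log_gap c / 2)\<close>, and
  after that only the product with \<open>sqrt c * log_gap c\<close> matters, in which the parameters no longer occur.\<close>
lemma error_bound_tendsto_0: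
  fixes L K :: real
  assumes "L > 0"
  defines "T \<equiv> \<lambda>c. 1 / (4 * L) * log_gap c"
  shows "((\<lambda>c. exp ((2 * L + K * sqrt c) * T c) * (K * sqrt c * T c)) \<longlongrightarrow> 0) (at_right 0)"
proof -
  define k where "k = K / (4 * L)"
  have "exp ((2 * L + K * sqrt c) * T c) * (K * sqrt c * T c) =
      k * (exp (log_gap c / 2) * (sqrt c * log_gap c)) * exp (k * (sqrt c * log_gap c))" for c
  proof -
    have e: "(2 * L + K * sqrt c) * T c = log_gap c / 2 + k * (sqrt c * log_gap c)"
      using assms(1) by (simp add: T_def k_def field_simps)
    have m: "K * sqrt c * T c = k * (sqrt c * log_gap c)"
      by (simp add: T_def k_def)
    show ?thesis unfolding e m exp_add by (simp only: mult_ac)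
  qed
  moreover have "((\<lambda>c. k * (exp (log_gap c / 2) * (sqrt c * log_gap c)) * exp (k * (sqrt c * log_gap c)))
      \<longlongrightarrow> k * 0 * exp (k * 0)) (at_right 0)"
    by (intro tendsto_intros exp_half_log_gap_tendsto_0 sqrt_log_gap_tendsto_0)
  ultimately show ?thesis by (simp only: mult_zero_right mult_zero_left)
qed

section \<open>Deviation from the differential equation\<close>

lemma steps_le: "0 \<le> t \<Longrightarrow> 0 < c \<Longrightarrow> real (steps c t) * c \<le> t"
  and less_Suc_steps: "0 \<le> t \<Longrightarrow> 0 < c \<Longrightarrow> t < (real (steps c t) + 1) * c"
proof -
  assume "0 \<le> t" "0 < c"
  then have "real (steps c t) \<le> t / c" "t / c < real (steps c t) + 1"
    unfolding steps_def by (auto simp: of_nat_nat)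
  then show "real (steps c t) * c \<le> t" "t < (real (steps c t) + 1) * c"
    using \<open>0 < c\<close> by (auto simp: field_simps)
qed

lemma half_line_flow_mvt:
  fixes f :: "real \<Rightarrow> real"
  assumes ode: "\<And>t. 0 \<le> t \<Longrightarrow> (f has_real_derivative b (f t)) (at t within {0..})"
    and t: "0 \<le> t" "t < u"
  obtains \<xi> where "t < \<xi>" "\<xi> < u" "f u - f t = b (f \<xi>) * (u - t)"
proof -
  have "\<exists>\<xi>\<in>{t<..<u}. f u - f t = (\<lambda>w. b (f \<xi>) * w) (u - t)"
  proof (rule mvt_simple)
    fix s assume "t \<le> s" "s \<le> u"
    then have "(f has_real_derivative b (f s)) (at s within {t..u})"
      using t by (intro DERIV_subset[OF ode]) auto
    then show "(f has_derivative (\<lambda>w. b (f s) * w)) (at s within {t..u})"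
      by (simp add: has_field_derivative_def)
  qed (use t in auto)
  then show ?thesis using that by auto
qed

lemma half_line_flow_lipschitz:
  fixes f :: "real \<Rightarrow> real"
  assumes ode: "\<And>t. 0 \<le> t \<Longrightarrow> (f has_real_derivative b (f t)) (at t within {0..})"
    and B: "\<And>y. \<bar>b y\<bar> \<le> B"
    and t: "0 \<le> t" "t \<le> u"
  shows "\<bar>f u - f t\<bar> \<le> B * (u - t)"
proof (cases "t = u")
  case False
  then have "t < u" using t by simp
  from half_line_flow_mvt[of f b, OF ode t(1) this] obtain \<xi> where "f u - f t = b (f \<xi>) * (u - t)" by metis
  then show ?thesis using B t by (simp add: abs_mult mult_right_mono)
qed simp

lemma half_line_flow_euler:
  fixes f :: "real \<Rightarrow> real"
  assumes ode: "\<And>t. 0 \<le> t \<Longrightarrow> (f has_real_derivative b (f t)) (at t within {0..})"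
    and B: "\<And>y. \<bar>b y\<bar> \<le> B" and L: "\<And>x y. \<bar>b x - b y\<bar> \<le> L * \<bar>x - y\<bar>" "0 \<le> L"
    and t: "0 \<le> t" and s: "0 < s"
  shows "\<bar>f (t + s) - f t - s * b (f t)\<bar> \<le> L * B * s\<^sup>2"
proof -
  have B0: "0 \<le> B" using B[of 0] by linarith
  obtain \<xi> where \<xi>: "t < \<xi>" "\<xi> < t + s" and eq: "f (t + s) - f t = b (f \<xi>) * (t + s - t)"
    using half_line_flow_mvt[of f b t "t + s"] ode t s by (metis less_add_same_cancel1)
  have "\<bar>f (t + s) - f t - s * b (f t)\<bar> = s * \<bar>b (f \<xi>) - b (f t)\<bar>"
  proof -
    have "f (t + s) - f t - s * b (f t) = s * (b (f \<xi>) - b (f t))"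
      using eq by (simp add: algebra_simps)
    then show ?thesis using s by (simp add: abs_mult)
  qed
  also have "\<dots> \<le> s * (L * (B * s))"
  proof (intro mult_left_mono)
    have "\<bar>f \<xi> - f t\<bar> \<le> B * (\<xi> - t)"
      using half_line_flow_lipschitz[of f b, OF ode B t] \<xi> by simp
    also have "\<dots> \<le> B * s" using \<xi> B0 by (intro mult_left_mono) auto
    finally have "L * \<bar>f \<xi> - f t\<bar> \<le> L * (B * s)" using L(2) by (rule mult_left_mono)
    with L(1) show "\<bar>b (f \<xi>) - b (f t)\<bar> \<le> L * (B * s)" by (rule order_trans)
  qed (use s in auto)
  finally show ?thesis by (simp add: power2_eq_square mult_ac)
qed

context smooth_circle_density
begin

lemma nn_integral_slit_step_le:
  assumes c: "0 \<le> c" and \<sigma>: "\<sigma> \<in> {-1, 1}"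
    and le: "(LINT y:{0..1}|lborel. (x + slit_shift \<sigma> c (x - y) - q)\<^sup>2 * h y) \<le> e"
  shows "(\<integral>\<^sup>+ y. ennreal ((x + slit_shift \<sigma> c (x - y) - q)\<^sup>2)
            \<partial>density lborel (\<lambda>y. ennreal (h y * indicator {0..1} y))) \<le> ennreal e"
proof -
  define w where "w y = (x + slit_shift \<sigma> c (x - y) - q)\<^sup>2" for y
  have [measurable]: "w \<in> borel_measurable borel" unfolding w_def[abs_def] by measurable
  obtain H where H: "0 \<le> H" "\<And>x. \<bar>h x\<bar> \<le> H" using density_bounds by metis
  have "\<bar>w y * h y\<bar> \<le> (\<bar>x\<bar> + 1 + \<bar>q\<bar>)\<^sup>2 * H" for y
  proof -
    have "\<bar>x + slit_shift \<sigma> c (x - y) - q\<bar> \<le> \<bar>x\<bar> + 1 + \<bar>q\<bar>"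
      using abs_slit_shift_le_one[OF c \<sigma>, of "x - y"] by linarith
    then have "w y \<le> (\<bar>x\<bar> + 1 + \<bar>q\<bar>)\<^sup>2"
      unfolding w_def by (subst power2_abs[symmetric]) (intro power_mono, auto)
    then show ?thesis
      using H by (auto simp: abs_mult w_def intro!: mult_mono)
  qed
  then have int: "set_integrable lborel {0..1} (\<lambda>y. w y * h y)"
    by (intro set_integrable_Icc_bounded) auto
  have "(\<integral>\<^sup>+ y. ennreal (w y) \<partial>density lborel (\<lambda>y. ennreal (h y * indicator {0..1} y)))
     = (\<integral>\<^sup>+ y. ennreal (indicator {0..1} y *\<^sub>R (w y * h y)) \<partial>lborel)"
    using density_nonneg
    by (subst nn_integral_density)
       (auto intro!: nn_integral_cong simp: ennreal_mult[symmetric] w_def mult_ac)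
  also have "\<dots> = ennreal (LINT y:{0..1}|lborel. w y * h y)"
    unfolding set_lebesgue_integral_def using int density_nonneg
    by (intro nn_integral_eq_integral) (auto simp: set_integrable_def w_def)
  also have "\<dots> \<le> ennreal e" using le unfolding w_def by (rule ennreal_leI)
  finally show ?thesis unfolding w_def .
qed

text \<open>The supremum over all times is reduced to the grid \<open>n * c\<close>: both the flow and the grid values of
  the solution are constant between grid points, while the solution itself moves by at most \<open>B * c\<close>,
  which the condition \<open>K * c \<le> \<epsilon>\<close> keeps below \<open>\<epsilon> / 2\<close>.\<close>
lemma flow_deviation_probability:
  fixes M :: "'a measure"
  assumes M: "prob_space M"
    and ind: "prob_space.indep_vars M (\<lambda>_. borel) \<theta> {1..}"
    and dist: "\<And>n. n \<ge> 1 \<Longrightarrow> distributed M lborel (\<theta> n) (\<lambda>y. ennreal (h y * indicator {0..1} y))"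
    and \<sigma>: "\<sigma> \<in> {-1, 1}"
    and f0: "f 0 = x" and ode: "\<And>t. 0 \<le> t \<Longrightarrow> (f has_real_derivative drift h (f t)) (at t within {0..})"
    and \<epsilon>: "0 < \<epsilon>"
  obtains K where "0 < K"
    "\<And>c T. 0 < c \<Longrightarrow> c \<le> 1 \<Longrightarrow> K * c \<le> \<epsilon> \<Longrightarrow> 0 \<le> T \<Longrightarrow>
       measure M {\<omega>\<in>space M. (SUP t\<in>{0..T}.
                ereal \<bar>harmonic_flow \<sigma> c (\<lambda>n. \<theta> n \<omega>) (steps c t) x - f t\<bar>) > ereal \<epsilon>}
       \<le> exp ((2 * drift_lip + K * sqrt c) * T) * (K * sqrt c * T) / (\<epsilon> / 2)\<^sup>2"
proof -
  interpret prob_space M by (rule M)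
  obtain B where B: "0 \<le> B" "\<And>x. \<bar>drift h x\<bar> \<le> B" using drift_bounded by metis
  obtain K0 where K0: "0 \<le> K0"
    "\<And>c p q x. 0 < c \<Longrightarrow> c \<le> 1 \<Longrightarrow> \<bar>q - p - c * drift h p\<bar> \<le> drift_lip * B * c\<^sup>2 \<Longrightarrow>
       (LINT y:{0..1}|lborel. (x + slit_shift \<sigma> c (x - y) - q)\<^sup>2 * h y)
         \<le> (1 + 2 * drift_lip * c + K0 * (c * sqrt c)) * (x - p)\<^sup>2 + K0 * (c * sqrt c)"
    using second_moment_step[OF \<sigma>, of "drift_lip * B"] by blast
  define K where "K = K0 + 2 * B + 1"
  have K: "0 < K" "K0 \<le> K" "2 * B \<le> K" using K0(1) B(1) by (auto simp: K_def)
  define \<mu> where "\<mu> = density lborel (\<lambda>y. ennreal (h y * indicator {0..1} y))"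
  have dist': "distr M borel (\<theta> n) = \<mu>" if "n \<ge> 1" for n
    using distributed_distr_eq_density[OF dist[OF that]] unfolding \<mu>_def
    by (metis distr_cong sets_lborel)
  have bound: "measure M {\<omega>\<in>space M. (SUP t\<in>{0..T}.
                ereal \<bar>harmonic_flow \<sigma> c (\<lambda>n. \<theta> n \<omega>) (steps c t) x - f t\<bar>) > ereal \<epsilon>}
       \<le> exp ((2 * drift_lip + K * sqrt c) * T) * (K * sqrt c * T) / (\<epsilon> / 2)\<^sup>2"
    if c: "0 < c" "c \<le> 1" and Kc: "K * c \<le> \<epsilon>" and T: "0 \<le> T" for c T
  proof -
    define N where "N = steps c T"
    define a d where "a = 2 * drift_lip * c + K * (c * sqrt c)" and "d = K * (c * sqrt c)"
    have d0: "0 \<le> d" and a0: "0 \<le> a" using K c drift_lip_nonneg by (auto simp: a_def d_def)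
    define p where "p n = f (real n * c)" for n
    let ?X = "\<lambda>\<omega> n. harmonic_flow \<sigma> c (\<lambda>i. \<theta> i \<omega>) n x"
    let ?B = "{\<omega>\<in>space M. \<exists>n\<le>N. \<epsilon> / 2 < \<bar>?X \<omega> n - p n\<bar>}"
    have step: "(\<integral>\<^sup>+ z. ennreal ((y + slit_shift \<sigma> c (y - z) - p (Suc n))\<^sup>2) \<partial>\<mu>)
        \<le> ennreal ((1 + a) * (y - p n)\<^sup>2 + d)" for n y
      unfolding \<mu>_def
    proof (rule nn_integral_slit_step_le)
      have "\<bar>f (real n * c + c) - f (real n * c) - c * drift h (f (real n * c))\<bar> \<le> drift_lip * B * c\<^sup>2"
        using c by (intro half_line_flow_euler ode B drift_lipschitz drift_lip_nonneg) auto
      then have "\<bar>p (Suc n) - p n - c * drift h (p n)\<bar> \<le> drift_lip * B * c\<^sup>2"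
        by (simp add: p_def algebra_simps)
      note K0(2)[OF c this, of y]
      also have "(1 + 2 * drift_lip * c + K0 * (c * sqrt c)) * (y - p n)\<^sup>2 + K0 * (c * sqrt c)
         \<le> (1 + a) * (y - p n)\<^sup>2 + d"
      proof -
        have "K0 * (c * sqrt c) \<le> K * (c * sqrt c)" using K c by (intro mult_right_mono) auto
        then have "1 + 2 * drift_lip * c + K0 * (c * sqrt c) \<le> 1 + a" "K0 * (c * sqrt c) \<le> d"
          by (simp_all add: a_def d_def)
        from add_mono[OF mult_right_mono[OF this(1) zero_le_power2] this(2)] show ?thesis .
      qed
      finally show "(LINT z:{0..1}|lborel. (y + slit_shift \<sigma> c (y - z) - p (Suc n))\<^sup>2 * h z)
          \<le> (1 + a) * (y - p n)\<^sup>2 + d" .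
    qed (use c \<sigma> in auto)
    have B_sets: "?B \<in> sets M"
      and prob: "prob ?B \<le> (1 + a) ^ N * (real N * d) / (\<epsilon> / 2)\<^sup>2"
    proof -
      have half: "0 < \<epsilon> / 2" and p0: "p 0 = x" using \<epsilon> f0 by (auto simp: p_def)
      note max = flow_maximal_inequality[OF ind dist' a0 d0 half p0 step]
      show "?B \<in> sets M" by (rule max(1))
      show "prob ?B \<le> (1 + a) ^ N * (real N * d) / (\<epsilon> / 2)\<^sup>2" by (rule max(2))
    qed
    have Nc: "real N * c \<le> T" using steps_le[OF T c(1)] by (simp add: N_def)
    have "\<epsilon> / 2 < \<bar>?X \<omega> (steps c t) - p (steps c t)\<bar>"
      if t: "t \<in> {0..T}" and gt: "\<epsilon> < \<bar>?X \<omega> (steps c t) - f t\<bar>" for \<omega> t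
    proof -
      have st: "real (steps c t) * c \<le> t" "t < (real (steps c t) + 1) * c"
        using steps_le[of t c] less_Suc_steps[of t c] t c by auto
      have "\<bar>f t - f (real (steps c t) * c)\<bar> \<le> B * (t - real (steps c t) * c)"
        using st c by (intro half_line_flow_lipschitz[of f "drift h"] ode B) auto
      also have "\<dots> \<le> B * c" using st B by (intro mult_left_mono) (auto simp: algebra_simps)
      also have "\<dots> \<le> \<epsilon> / 2" using order_trans[OF mult_right_mono[OF K(3) less_imp_le[OF c(1)]] Kc] by simp
      finally show ?thesis using gt unfolding p_def by linarith
    qed
    moreover have "steps c t \<le> N" if "t \<in> {0..T}" for t
      using that c unfolding N_def steps_def by (intro nat_mono floor_mono divide_right_mono) auto
    ultimately have "{\<omega>\<in>space M. (SUP t\<in>{0..T}. ereal \<bar>?X \<omega> (steps c t) - f t\<bar>) > ereal \<epsilon>} \<subseteq> ?B"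
      by (auto simp: less_SUP_iff) blast
    then have "measure M {\<omega>\<in>space M. (SUP t\<in>{0..T}. ereal \<bar>?X \<omega> (steps c t) - f t\<bar>) > ereal \<epsilon>} \<le> prob ?B"
      using B_sets by (rule finite_measure_mono)
    also note prob
    also have "(1 + a) ^ N * (real N * d) / (\<epsilon> / 2)\<^sup>2
        \<le> exp ((2 * drift_lip + K * sqrt c) * T) * (K * sqrt c * T) / (\<epsilon> / 2)\<^sup>2"
    proof (rule divide_right_mono[OF mult_mono])
      have "(1 + a) ^ N \<le> exp a ^ N" using a0 by (intro power_mono) auto
      also have "\<dots> = exp (real N * a)" by (simp add: exp_of_nat_mult)
      also have "\<dots> \<le> exp ((2 * drift_lip + K * sqrt c) * T)"
        using mult_left_mono[OF Nc, of "2 * drift_lip + K * sqrt c"] drift_lip_nonneg K c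
        by (simp add: a_def algebra_simps)
      finally show "(1 + a) ^ N \<le> exp ((2 * drift_lip + K * sqrt c) * T)" .
      show "real N * d \<le> K * sqrt c * T"
        using mult_left_mono[OF Nc, of "K * sqrt c"] K c by (simp add: d_def algebra_simps)
    qed (use d0 in auto)
    finally show ?thesis .
  qed
  show ?thesis by (rule that[OF K(1) bound])
qed

end

theorem theorem3p4:
  fixes M :: "'a measure"
    and \<theta> :: "nat \<Rightarrow> 'a \<Rightarrow> real"
    and h :: "real \<Rightarrow> real"
    and \<psi> :: "real \<Rightarrow> real \<Rightarrow> real"
    and \<sigma> x \<epsilon> :: real
  assumes "prob_space M"
    and "circle_density h"
    and "twice_cont_diff h"
    and "\<not> h constant_on UNIV"
    and "prob_space.indep_vars M (\<lambda>_. borel) \<theta> {1..}"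
    and "\<And>n. n \<ge> 1 \<Longrightarrow> distributed M lborel (\<theta> n) (\<lambda>y. ennreal (h y * indicator {0..1} y))"
    and "\<sigma> \<in> {-1, 1}"
    and "\<And>y. \<psi> 0 y = y"
    and "\<And>t y. t \<ge> 0 \<Longrightarrow>
           ((\<lambda>s. \<psi> s y) has_real_derivative drift h (\<psi> t y)) (at t within {0..})"
    and "\<epsilon> > 0"
  shows "((\<lambda>c. \<P>(\<omega> in M.
             (SUP t\<in>{0..time_horizon h c}.
                ereal \<bar>harmonic_flow \<sigma> c (\<lambda>n. \<theta> n \<omega>) (steps c t) x - \<psi> t x\<bar>) > ereal \<epsilon>))
           \<longlongrightarrow> 0) (at_right 0)"
proof -
  interpret smooth_circle_density h using assms(2,3) by unfold_locales
  obtain K where K: "0 < K" 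
    "\<And>c T. 0 < c \<Longrightarrow> c \<le> 1 \<Longrightarrow> K * c \<le> \<epsilon> \<Longrightarrow> 0 \<le> T \<Longrightarrow>
       measure M {\<omega>\<in>space M. (SUP t\<in>{0..T}.
                ereal \<bar>harmonic_flow \<sigma> c (\<lambda>n. \<theta> n \<omega>) (steps c t) x - \<psi> t x\<bar>) > ereal \<epsilon>}
       \<le> exp ((2 * drift_lip + K * sqrt c) * T) * (K * sqrt c * T) / (\<epsilon> / 2)\<^sup>2"
    using flow_deviation_probability[where f="\<lambda>t. \<psi> t x" and x=x and M=M and \<theta>=\<theta> and \<sigma>=\<sigma> and \<epsilon>=\<epsilon>] assms by blast
  define \<beta> where "\<beta> c = exp ((2 * drift_lip + K * sqrt c) * time_horizon h c) * (K * sqrt c * time_horizon h c)" for c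
  have horizon: "time_horizon h c = 1 / (4 * drift_lip) * log_gap c" for c
    by (simp add: time_horizon_def drift_lip_def log_gap_def)
  \<comment> \<open>If the derivative of the drift vanishes identically, the quotient in the time horizon has
    denominator zero; it is then \<open>0\<close>, so the horizon is \<open>0\<close> and so is the bound.\<close>
  have "(\<beta> \<longlongrightarrow> 0) (at_right 0) \<and> (\<forall>\<^sub>F c in at_right 0. 0 \<le> time_horizon h c)"
  proof (cases "drift_lip = 0")
    case True
    then show ?thesis by (simp add: \<beta>_def[abs_def] horizon)
  next
    case False
    then have L: "0 < drift_lip" using drift_lip_nonneg by simp
    have "(\<beta> \<longlongrightarrow> 0) (at_right 0)"
      unfolding \<beta>_def[abs_def] horizon by (rule error_bound_tendsto_0[OF L])
    moreover have "\<forall>\<^sub>F c in at_right 0. 0 \<le> time_horizon h c"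
      using log_gap_nonneg by eventually_elim (use L in \<open>simp add: horizon\<close>)
    ultimately show ?thesis ..
  qed
  then have lim: "((\<lambda>c. \<beta> c / (\<epsilon> / 2)\<^sup>2) \<longlongrightarrow> 0) (at_right 0)" and T: "\<forall>\<^sub>F c in at_right 0. 0 \<le> time_horizon h c"
    by (auto intro: tendsto_divide_zero)
  have "\<forall>\<^sub>F c in at_right 0. c \<in> {0<..<min 1 (\<epsilon> / K)}"
    using \<open>\<epsilon> > 0\<close> K(1) by (intro eventually_at_rightI[of 0 "min 1 (\<epsilon> / K)"]) auto
  with T have "\<forall>\<^sub>F c in at_right 0. \<P>(\<omega> in M.
             (SUP t\<in>{0..time_horizon h c}.
                ereal \<bar>harmonic_flow \<sigma> c (\<lambda>n. \<theta> n \<omega>) (steps c t) x - \<psi> t x\<bar>) > ereal \<epsilon>) \<le> \<beta> c / (\<epsilon> / 2)\<^sup>2"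
  proof eventually_elim
    case (elim c)
    then have "K * c \<le> \<epsilon>" using K(1) by (auto simp: field_simps)
    then show ?case unfolding \<beta>_def using K(2)[of c "time_horizon h c"] elim by auto
  qed
  then show ?thesis
    by (intro tendsto_sandwich[OF _ _ tendsto_const lim]) simp_all
qed

end
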